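(* Consider the large dimensional proportional regime in which $n,m,k_1,k_2$ are positive integers with $$\alpha=\lim_{n\to\infty}\frac{m}{n},\qquad \beta_1=\lim_{n\to\infty}\frac{k_1}{n},\qquad \beta_2=\lim_{n\to\infty}\frac{k_2}{n}.$$ Let each element of $\mathbf{h}\in\mathbb{R}^m$ and $\mathbf{g}\in\mathbb{R}^n$ be a standard normal random variable independent of any other randomness. Set $$L=\frac{1}{\sqrt{k_1k_2}}\max_{\mathbf{x}\in\mathcal{S}_{\mathbf{x}},\,\mathbf{y}\in\mathcal{S}_{\mathbf{y}}}\left(\mathbf{h}^T\mathbf{y}+\mathbf{g}^T\mathbf{x}\right).$$ For $A\in\mathbb{R}^{m\times n}$ comprised of independent standard normal entries, let $\xi$ be its largest average $k_1\times k_2$ submatrix value. Then $$\lim_{n\to\infty}\mathbb{E}\,\xi\sqrt{n}\ \le\ \lim_{n\to\infty}\mathbb{E}\,L\sqrt{n},$$ with the right-hand side being the (so-called) random dual.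
   Context: For $A\in\mathbb{R}^{m\times n}$, the largest average $k_1\times k_2$ submatrix value is $$\xi=\frac{1}{k_1k_2}\max_{\substack{I_1\subset\{1,\dots,m\},\ |I_1|=k_1\\ I_2\subset\{1,\dots,n\},\ |I_2|=k_2}}\ \sum_{i\in I_1,\,j\in I_2}A_{ij}=\frac{1}{\sqrt{k_1k_2}}\max_{\mathbf{x}\in\mathcal{S}_{\mathbf{x}},\,\mathbf{y}\in\mathcal{S}_{\mathbf{y}}}\mathbf{y}^TA\mathbf{x},$$ where $\mathcal{S}_{\mathbf{x}}=\{\mathbf{x}\in\mathbb{R}^n:\ \mathbf{x}_i\in\{0,1/\sqrt{k_2}\}\text{ for all }i,\ \sum_{i=1}^n\mathbf{x}_i=\sqrt{k_2}\}$ and $\mathcal{S}_{\mathbf{y}}=\{\mathbf{y}\in\mathbb{R}^m:\ \mathbf{y}_i\in\{0,1/\sqrt{k_1}\}\text{ for all }i,\ \sum_{i=1}^m\mathbf{y}_i=\sqrt{k_1}\}$ (unit-norm scaled indicator vectors of $k_2$-subsets and $k_1$-subsets). *)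

theory Defs
  imports "HOL-Probability.Probability"
begin

definition largest_avg_submatrix ::
  "nat \<Rightarrow> nat \<Rightarrow> nat \<Rightarrow> nat \<Rightarrow> (nat \<Rightarrow> nat \<Rightarrow> real) \<Rightarrow> real" where
  "largest_avg_submatrix m n k1 k2 A =
     1 / (real k1 * real k2) *
     Max {\<Sum>i\<in>I1. \<Sum>j\<in>I2. A i j | I1 I2.
            I1 \<subseteq> {1..m} \<and> card I1 = k1 \<and> I2 \<subseteq> {1..n} \<and> card I2 = k2}"

(* Vectors of R^d are functions on {1..d}, extended by undefined outside. *)
definition scaled_indicators :: "nat \<Rightarrow> nat \<Rightarrow> (nat \<Rightarrow> real) set" where
  "scaled_indicators d k =
     {x \<in> {1..d} \<rightarrow>\<^sub>E {0, 1 / sqrt (real k)}. (\<Sum>i=1..d. x i) = sqrt (real k)}"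

definition random_dual ::
  "nat \<Rightarrow> nat \<Rightarrow> nat \<Rightarrow> nat \<Rightarrow> (nat \<Rightarrow> real) \<Rightarrow> (nat \<Rightarrow> real) \<Rightarrow> real" where
  "random_dual m n k1 k2 h g =
     1 / sqrt (real k1 * real k2) *
     Max {(\<Sum>i=1..m. h i * y i) + (\<Sum>j=1..n. g j * x j) | x y.
            x \<in> scaled_indicators n k2 \<and> y \<in> scaled_indicators m k1}"

end

theory Submission
  imports Defs
begin

text \<open>
  The bound on \<open>\<xi>\<close> holds for every fixed \<open>n\<close>. For unit vectors the squared increments of
  \<open>y\<^sup>T A x\<close> and of \<open>h\<^sup>T y + g\<^sup>T x\<close> differ by \<open>2 (1 - \<langle>x, x'\<rangle>) (1 - \<langle>y, y'\<rangle>) \<ge> 0\<close>, so the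
  Sudakov--Fernique comparison applies. That comparison is proved for the smooth maximum
  \<open>ln (\<Sum>x\<in>T. exp (v x))\<close> by a Lindeberg argument instead of Gaussian integration by parts: the
  variances are interpolated linearly in \<open>N\<close> steps; in one step the Taylor term of second order
  is \<open>1/4 \<Sum> p x p y E (X x - X y)\<^sup>2\<close> with Gibbs weights \<open>p\<close>, which is monotone in the increments,
  and the remainders of size \<open>N powr (-3/2)\<close> add up to \<open>O(1 / sqrt N)\<close>.

  For the existence of the limit of \<open>E L sqrt n\<close>, the dual splits into two sums of the largest
  entries of a Gaussian vector. The sum of the \<open>k\<close> largest of \<open>d\<close> entries is compared with the sum
  of the entries above the threshold \<open>t\<close> with \<open>P (g > t) = lim k / d\<close>; by Cauchy--Schwarz the error
  is controlled by the deviation of the number of such entries from \<open>k\<close>, which is \<open>o(n)\<close> in mean.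
\<close>

section \<open>The smooth maximum\<close>

text \<open>Expanding the square makes every double sum factor, and \<open>sum p T = 1\<close>
  removes the marginal factors. The pairwise form of the variance is what lets only increments enter
  the comparison later.\<close>

lemma Var_pairwise:
  fixes p w :: "'t \<Rightarrow> real"
  assumes "sum p T = 1"
  shows "(\<Sum>x\<in>T. p x * w x ^ 2) - (\<Sum>x\<in>T. p x * w x) ^ 2
       = 1/2 * (\<Sum>x\<in>T. \<Sum>y\<in>T. p x * p y * (w x - w y) ^ 2)"
proof -
  have "(\<Sum>x\<in>T. \<Sum>y\<in>T. p x * p y * (w x - w y) ^ 2)
      = (\<Sum>x\<in>T. \<Sum>y\<in>T. (p x * w x ^ 2) * p y) + (\<Sum>x\<in>T. \<Sum>y\<in>T. p x * (p y * w y ^ 2))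
        - 2 * (\<Sum>x\<in>T. \<Sum>y\<in>T. (p x * w x) * (p y * w y))"
    by (simp add: sum.distrib[symmetric] sum_subtractf[symmetric] sum_distrib_left)
       (intro sum.cong refl; simp add: power2_eq_square algebra_simps)
  also have "\<dots> = 2 * ((\<Sum>x\<in>T. p x * w x ^ 2) - (\<Sum>x\<in>T. p x * w x) ^ 2)"
    by (simp only: sum_product[symmetric] assms power2_eq_square[of "sum _ _"]) simp
  finally show ?thesis by simp
qed

text \<open>As a function of \<open>t\<close>, \<open>ln (sum of exp (v x + t * w x))\<close> is a
  cumulant generating function up to a constant: its derivatives are the cumulants of
  \<open>w\<close> under tilted Gibbs weights. The first is a mean, the second a variance, and the
  third is at most \<open>6 * W^3\<close> uniformly in \<open>t\<close>, so the Lagrange remainder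
  with \<open>fact 3 = 6\<close> gives the constant 1.\<close>

lemma ln_sum_exp_Taylor:
  fixes v w :: "'t \<Rightarrow> real" and r W :: real
  assumes T: "finite T" "T \<noteq> {}" and r: "0 \<le> r" and W: "\<And>x. x \<in> T \<Longrightarrow> \<bar>w x\<bar> \<le> W"
  defines "p \<equiv> \<lambda>x. exp (v x) / (\<Sum>x\<in>T. exp (v x))"
  shows "\<bar>ln (\<Sum>x\<in>T. exp (v x + r * w x)) - ln (\<Sum>x\<in>T. exp (v x)) - r * (\<Sum>x\<in>T. p x * w x)
           - r^2 / 4 * (\<Sum>x\<in>T. \<Sum>y\<in>T. p x * p y * (w x - w y)^2)\<bar> \<le> r^3 * W^3"
proof (cases "r = 0")
  case False
  with r have r0: "0 < r" by simp
  obtain x0 where "x0 \<in> T" using T by auto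
  with W[of x0] have W0: "0 \<le> W" by linarith
  \<comment> \<open>\<open>S k t\<close> is the unnormalised and \<open>m k t\<close> the normalised
    \<open>k\<close>-th moment of \<open>w\<close> under the weights
    \<open>exp (v x + t * w x)\<close>. By the quotient rule the derivative of \<open>m k\<close> is
    the Gibbs covariance of \<open>w ^ k\<close> and \<open>w\<close>.\<close>
  define S where "S k t = (\<Sum>x\<in>T. w x ^ k * exp (v x + t * w x))" for k t
  define m where "m k t = S k t / S 0 t" for k t
  have S0: "0 < S 0 t" for t using T by (auto simp: S_def intro!: sum_pos)
  have dS: "(S k has_real_derivative S (Suc k) t) (at t)" for k t
    unfolding S_def by (auto intro!: derivative_eq_intros sum.cong)
  have dm: "(m k has_real_derivative (m (Suc k) t - m k t * m 1 t)) (at t)" for k t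
    unfolding m_def using S0[of t]
    by (auto intro!: derivative_eq_intros dS simp: field_simps power2_eq_square)
  have mb: "\<bar>m k t\<bar> \<le> W ^ k" for k t
  proof -
    have "\<bar>S k t\<bar> \<le> (\<Sum>x\<in>T. W ^ k * exp (v x + t * w x))"
      unfolding S_def
      by (rule order_trans[OF sum_abs])
         (auto simp: abs_mult power_abs intro!: sum_mono mult_right_mono power_mono W)
    also have "\<dots> = W ^ k * S 0 t" by (simp add: S_def sum_distrib_left)
    finally show ?thesis using S0[of t] by (simp add: m_def field_simps abs_divide)
  qed
  \<comment> \<open>The log partition function followed by its first three derivatives, namely mean,
    variance and third cumulant written in raw moments.\<close>
  define d where "d k t = (if k = 0 then ln (S 0 t) else if k = 1 then m 1 t
      else if k = 2 then m 2 t - m 1 t ^ 2 else m 3 t - 3 * m 2 t * m 1 t + 2 * m 1 t ^ 3)" for k :: nat and t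
  have dfun: "d 0 = (\<lambda>t. ln (S 0 t))" "d 1 = m 1" "d 2 = (\<lambda>t. m 2 t - m 1 t ^ 2)"
    "d 3 = (\<lambda>t. m 3 t - 3 * m 2 t * m 1 t + 2 * m 1 t ^ 3)"
    by (auto simp: d_def)
  have d0: "(d 0 has_real_derivative d 1 t) (at t)" for t
    using dS[of 0 t] S0[of t] unfolding dfun by (auto simp: m_def intro!: derivative_eq_intros)
  have d1: "(d 1 has_real_derivative d 2 t) (at t)" for t
    using dm[of 1 t] unfolding dfun by (simp add: power2_eq_square numeral_2_eq_2)
  have d2: "(d 2 has_real_derivative d 3 t) (at t)" for t
    using dm[of 1 t] dm[of 2 t] unfolding dfun
    by (auto intro!: derivative_eq_intros simp: algebra_simps power2_eq_square power3_eq_cube numeral_2_eq_2 numeral_3_eq_3)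
  have "\<exists>t>0. t < r \<and> d 0 r = (\<Sum>k<3. d k 0 / fact k * r ^ k) + d 3 t / fact 3 * r ^ 3"
  proof (rule Maclaurin)
    have "k < 3 \<Longrightarrow> (d k has_real_derivative d (Suc k) t) (at t)" for k t
      using d0[of t] d1[of t] d2[of t] by (auto simp: less_Suc_eq numeral_3_eq_3 numeral_2_eq_2)
    then show "\<forall>k t. k < 3 \<and> 0 \<le> t \<and> t \<le> r \<longrightarrow> DERIV (d k) t :> d (Suc k) t" by auto
  qed (use r0 in auto)
  then obtain t where t: "d 0 r = (\<Sum>k<3. d k 0 / fact k * r ^ k) + d 3 t / fact 3 * r ^ 3" by auto
  \<comment> \<open>The coefficients 1, 3 and 2 of the third cumulant add up to 6.\<close>
  have b: "\<bar>d 3 t\<bar> \<le> 6 * W^3"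
  proof -
    have "\<bar>m 2 t * m 1 t\<bar> \<le> W^2 * W" using mb[of 2 t] mb[of 1 t] W0 unfolding abs_mult
      by (intro mult_mono) auto
    moreover have "\<bar>m 1 t ^ 3\<bar> \<le> W^3" using mb[of 1 t] by (simp add: power_abs power_mono)
    moreover have "\<bar>m 3 t\<bar> \<le> W^3" by (rule mb)
    moreover have "W^2 * W = W^3" by (simp add: power2_eq_square power3_eq_cube)
    ultimately show ?thesis unfolding dfun by (simp add: abs_le_iff)
  qed
  have p1: "sum p T = 1" using S0[of 0] by (simp add: p_def S_def sum_divide_distrib[symmetric])
  have m0: "m k 0 = (\<Sum>x\<in>T. p x * w x ^ k)" for k
    by (simp add: m_def S_def p_def sum_divide_distrib algebra_simps)
  define V where "V = (\<Sum>x\<in>T. \<Sum>y\<in>T. p x * p y * (w x - w y) ^ 2)"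
  have e2: "d 2 0 = 1/2 * V"
    using Var_pairwise[OF p1, of w] by (simp add: d_def m0 V_def)
  have e1: "d 1 0 = (\<Sum>x\<in>T. p x * w x)" by (simp add: d_def m0)
  have e0: "d 0 0 = ln (\<Sum>x\<in>T. exp (v x))" "d 0 r = ln (\<Sum>x\<in>T. exp (v x + r * w x))"
    by (simp_all add: d_def S_def)
  have er: "d 0 r = d 0 0 + r * d 1 0 + r^2 / 2 * d 2 0 + d 3 t / 6 * r ^ 3"
    using t by (simp add: lessThan_Suc eval_nat_numeral)
  have "ln (\<Sum>x\<in>T. exp (v x + r * w x)) - ln (\<Sum>x\<in>T. exp (v x)) - r * (\<Sum>x\<in>T. p x * w x)
           - r^2 / 4 * V = d 3 t / 6 * r ^ 3"
    using er[unfolded e0 e1 e2] by (simp add: algebra_simps)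
  moreover have "\<bar>d 3 t / 6 * r ^ 3\<bar> \<le> W ^ 3 * r ^ 3"
    using b r0 W0 unfolding abs_mult by (intro mult_mono) auto
  ultimately show ?thesis by (simp add: V_def mult.commute)
qed (auto)

section \<open>Gaussian comparison\<close>

text \<open>Independence factors the characteristic function of the left side into two Gaussian
  ones, whose exponents add to that of \<open>c * x\<close>. Only \<open>c^2\<close> enters, so the
  sign of \<open>c\<close> is free.\<close>

lemma distr_std_normal_rotation:
  fixes a b c :: real
  assumes c: "c^2 = a^2 + b^2"
  defines "N \<equiv> std_normal_distribution"
  shows "distr (N \<Otimes>\<^sub>M N) borel (\<lambda>(x, y). a * x + b * y) = distr N borel (\<lambda>x. c * x)"
proof -
  interpret N: real_distribution N unfolding N_def by (rule real_dist_normal_dist)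
  interpret NN: pair_prob_space N N ..
  have M[measurable]: "(\<lambda>(x, y). a * x + b * y) \<in> borel_measurable (N \<Otimes>\<^sub>M N)"
    by measurable
  have "char (distr (N \<Otimes>\<^sub>M N) borel (\<lambda>(x, y). a * x + b * y)) t = char (distr N borel (\<lambda>x. c * x)) t" for t
  proof -
    have "char (distr (N \<Otimes>\<^sub>M N) borel (\<lambda>(x, y). a * x + b * y)) t
        = (\<integral>p. iexp (t * (case p of (x, y) \<Rightarrow> a * x + b * y)) \<partial>(N \<Otimes>\<^sub>M N))"
      unfolding char_def by (subst integral_distr) auto
    also have "\<dots> = (\<integral>p. (case p of (x, y) \<Rightarrow> iexp (t * a * x) * iexp (t * b * y)) \<partial>(N \<Otimes>\<^sub>M N))"
      by (intro Bochner_Integration.integral_cong) (auto simp: exp_add[symmetric] algebra_simps)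
    also have "\<dots> = (\<integral>x. \<integral>y. iexp (t * a * x) * iexp (t * b * y) \<partial>N \<partial>N)"
      by (subst NN.integral_fst'[symmetric])
         (auto intro!: NN.P.integrable_const_bound[where B = 1] simp: norm_mult)
    also have "\<dots> = char N (t * a) * char N (t * b)"
      by (simp add: char_def)
    also have "\<dots> = char N (t * c)"
      unfolding N_def char_std_normal_distribution using c
      by (simp add: of_real_mult[symmetric] exp_add[symmetric] power_mult_distrib field_simps del: of_real_mult)
    also have "\<dots> = char (distr N borel (\<lambda>x. c * x)) t"
      unfolding char_def by (subst integral_distr) (auto simp: mult.assoc)
    finally show ?thesis .
  qed
  then show ?thesis
    by (intro Levy_uniqueness ext NN.P.real_distribution_distr N.real_distribution_distr) auto
qed

lemma emeasure_distr_indicator: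
  assumes "f \<in> measurable M N" "B \<in> sets N"
  shows "emeasure (distr M N f) B = (\<integral>\<^sup>+x. indicator B (f x) \<partial>M)"
  using assms nn_integral_distr[of f M N "indicator B"] by simp

abbreviation gauss :: "'d set \<Rightarrow> ('d \<Rightarrow> real) measure" where
  "gauss D \<equiv> PiM D (\<lambda>_. std_normal_distribution)"

text \<open>Both sides are the product of the laws \<open>Q d\<close>. On boxes the indicator
  factors over coordinates, so Tonelli leaves the one-dimensional rotation identity in each
  coordinate. The lemma serves to split a Gaussian vector into a large and an independent small
  part.\<close>

lemma distr_gauss_add:
  fixes a b c :: "'d \<Rightarrow> real"
  assumes D: "finite D" and c: "\<And>d. d \<in> D \<Longrightarrow> (c d)^2 = (a d)^2 + (b d)^2"
  shows "distr (gauss D \<Otimes>\<^sub>M gauss D) (PiM D (\<lambda>_. borel)) (\<lambda>(z, z'). \<lambda>d\<in>D. a d * z d + b d * z' d)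
       = distr (gauss D) (PiM D (\<lambda>_. borel)) (\<lambda>z. \<lambda>d\<in>D. c d * z d)"
proof -
  let ?N = "std_normal_distribution"
  interpret N: real_distribution ?N by (rule real_dist_normal_dist)
  interpret NN: pair_prob_space ?N ?N ..
  interpret P: product_prob_space "\<lambda>_. ?N" D ..
  define Q where "Q d = distr ?N borel (\<lambda>x. c d * x)" for d
  interpret Q: prob_space "Q d" for d unfolding Q_def by (rule N.prob_space_distr) auto
  interpret PQ: product_prob_space Q D ..
  have sQ[measurable_cong]: "sets (Q d) = sets borel" for d by (simp add: Q_def)
  have sP: "sets (PiM D Q) = sets (PiM D (\<lambda>_. borel))" by (intro sets_PiM_cong) (auto simp: sQ)
  \<comment> \<open>Restriction to \<open>D\<close> makes the vector extensional, so lying in the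
    box is a condition on the coordinates in \<open>D\<close> alone.\<close>
  have ind: "indicator (Pi\<^sub>E D A) (\<lambda>d\<in>D. f d) = (\<Prod>d\<in>D. indicator (A d) (f d) :: ennreal)" for A :: "'d \<Rightarrow> real set" and f
    using D by (auto simp: indicator_def prod_eq_1_iff Pi_def PiE_def extensional_def)
  have cm[measurable]: "(\<lambda>x. c d * x) \<in> borel_measurable borel" for d by measurable
  have eQ: "emeasure (Q d) B = (\<integral>\<^sup>+x. indicator B (c d * x) \<partial>?N)" if "B \<in> sets borel" for B d
    unfolding Q_def using that by (intro emeasure_distr_indicator) auto
  have "PiM D Q = distr (gauss D) (PiM D (\<lambda>_. borel)) (\<lambda>z. \<lambda>d\<in>D. c d * z d)"
  proof (rule PQ.PiM_eqI[symmetric])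
    fix A assume "\<And>d. d \<in> D \<Longrightarrow> A d \<in> sets (Q d)"
    then have A[measurable]: "\<And>d. d \<in> D \<Longrightarrow> A d \<in> sets borel" by (simp add: sQ)
    then have PA[measurable]: "Pi\<^sub>E D A \<in> sets (PiM D (\<lambda>_. borel))" using D by (intro sets_PiM_I_finite)
    have "emeasure (distr (gauss D) (PiM D (\<lambda>_. borel)) (\<lambda>z. \<lambda>d\<in>D. c d * z d)) (Pi\<^sub>E D A)
       = (\<integral>\<^sup>+z. indicator (Pi\<^sub>E D A) (\<lambda>d\<in>D. c d * z d) \<partial>gauss D)"
      by (intro emeasure_distr_indicator) auto
    also have "\<dots> = (\<integral>\<^sup>+z. (\<Prod>d\<in>D. indicator (A d) (c d * z d)) \<partial>gauss D)"
      unfolding ind ..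
    also have "\<dots> = (\<Prod>d\<in>D. \<integral>\<^sup>+x. indicator (A d) (c d * x) \<partial>?N)"
      using D by (intro P.product_nn_integral_prod) auto
    finally show "emeasure (distr (gauss D) (PiM D (\<lambda>_. borel)) (\<lambda>z. \<lambda>d\<in>D. c d * z d)) (Pi\<^sub>E D A) = (\<Prod>d\<in>D. emeasure (Q d) (A d))"
      by (simp add: eQ)
  qed (use D sP in auto)
  moreover have "PiM D Q = distr (gauss D \<Otimes>\<^sub>M gauss D) (PiM D (\<lambda>_. borel)) (\<lambda>(z, z'). \<lambda>d\<in>D. a d * z d + b d * z' d)"
    (is "_ = ?L")
  proof (rule PQ.PiM_eqI[symmetric])
    fix A assume "\<And>d. d \<in> D \<Longrightarrow> A d \<in> sets (Q d)"
    then have A[measurable]: "\<And>d. d \<in> D \<Longrightarrow> A d \<in> sets borel" by (simp add: sQ)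
    then have PA[measurable]: "Pi\<^sub>E D A \<in> sets (PiM D (\<lambda>_. borel))" using D by (intro sets_PiM_I_finite)
    have "emeasure ?L (Pi\<^sub>E D A)
       = (\<integral>\<^sup>+p. indicator (Pi\<^sub>E D A) (case p of (z, z') \<Rightarrow> \<lambda>d\<in>D. a d * z d + b d * z' d) \<partial>(gauss D \<Otimes>\<^sub>M gauss D))"
      by (intro emeasure_distr_indicator) auto
    also have "\<dots> = (\<integral>\<^sup>+z. \<integral>\<^sup>+z'. indicator (Pi\<^sub>E D A) (\<lambda>d\<in>D. a d * z d + b d * z' d) \<partial>gauss D \<partial>gauss D)"
      by (subst P.nn_integral_fst[symmetric]) auto
    also have "\<dots> = (\<integral>\<^sup>+z. \<integral>\<^sup>+z'. (\<Prod>d\<in>D. indicator (A d) (a d * z d + b d * z' d)) \<partial>gauss D \<partial>gauss D)"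
      unfolding ind ..
    also have "\<dots> = (\<integral>\<^sup>+z. (\<Prod>d\<in>D. \<integral>\<^sup>+y. indicator (A d) (a d * z d + b d * y) \<partial>?N) \<partial>gauss D)"
      using D by (intro nn_integral_cong P.product_nn_integral_prod) auto
    also have "\<dots> = (\<Prod>d\<in>D. \<integral>\<^sup>+x. \<integral>\<^sup>+y. indicator (A d) (a d * x + b d * y) \<partial>?N \<partial>?N)"
      using D by (intro P.product_nn_integral_prod) auto
    also have "\<dots> = (\<Prod>d\<in>D. emeasure (Q d) (A d))"
    proof (intro prod.cong refl)
      fix d assume d: "d \<in> D"
      then have "emeasure (Q d) (A d) = emeasure (distr (?N \<Otimes>\<^sub>M ?N) borel (\<lambda>(x, y). a d * x + b d * y)) (A d)"
        unfolding Q_def by (subst distr_std_normal_rotation[OF c]) auto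
      also have "\<dots> = (\<integral>\<^sup>+p. indicator (A d) (case p of (x, y) \<Rightarrow> a d * x + b d * y) \<partial>(?N \<Otimes>\<^sub>M ?N))"
        using d by (intro emeasure_distr_indicator) auto
      also have "\<dots> = (\<integral>\<^sup>+x. \<integral>\<^sup>+y. indicator (A d) (a d * x + b d * y) \<partial>?N \<partial>?N)"
        using d by (subst N.nn_integral_fst[symmetric]) auto
      finally show "(\<integral>\<^sup>+x. \<integral>\<^sup>+y. indicator (A d) (a d * x + b d * y) \<partial>?N \<partial>?N) = emeasure (Q d) (A d)" ..
    qed
    finally show "emeasure ?L (Pi\<^sub>E D A) = (\<Prod>d\<in>D. emeasure (Q d) (A d))" .
  qed (use D sP in auto)
  ultimately show ?thesis by simp
qed

section \<open>Moments of linear forms in a standard Gaussian vector\<close>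

context
  fixes D :: "'d set"
  assumes D: "finite D"
begin

interpretation N: real_distribution std_normal_distribution by (rule real_dist_normal_dist)
interpretation P: product_prob_space "\<lambda>_. std_normal_distribution" D ..

lemma
  fixes f :: "real \<Rightarrow> real"
  assumes d: "d \<in> D" and f[measurable]: "f \<in> borel_measurable borel"
  shows integral_gauss_component: "(\<integral>z. f (z d) \<partial>gauss D) = (\<integral>x. f x \<partial>std_normal_distribution)"
    and integrable_gauss_component: "integrable (gauss D) (\<lambda>z. f (z d)) \<longleftrightarrow> integrable std_normal_distribution f"
proof -
  have m: "(\<lambda>z. z d) \<in> gauss D \<rightarrow>\<^sub>M std_normal_distribution"
    using d by (rule measurable_component_singleton)
  have f': "f \<in> borel_measurable std_normal_distribution" using f by simp
  have *: "distr (gauss D) std_normal_distribution (\<lambda>z. z d) = std_normal_distribution"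
    using P.PiM_component[OF d] by simp
  show "(\<integral>z. f (z d) \<partial>gauss D) = (\<integral>x. f x \<partial>std_normal_distribution)"
    using integral_distr[OF m f'] by (simp add: *)
  show "integrable (gauss D) (\<lambda>z. f (z d)) \<longleftrightarrow> integrable std_normal_distribution f"
    using integrable_distr_eq[OF m f'] by (simp add: *)
qed

lemma integrable_gauss_abs_power: "d \<in> D \<Longrightarrow> integrable (gauss D) (\<lambda>z. \<bar>z d\<bar> ^ k)"
  by (subst integrable_gauss_component[where f = "\<lambda>x. \<bar>x\<bar>^k"])
     (auto simp: integrable_density normal_density_nonneg integrable_std_normal_moment_abs)

lemma integrable_gauss_id: "d \<in> D \<Longrightarrow> integrable (gauss D) (\<lambda>z. z d)"
  using integrable_gauss_component[of d "\<lambda>x. x"] integrable_std_normal_distribution_moment[of 1] by simp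

lemma integral_gauss_id: "d \<in> D \<Longrightarrow> (\<integral>z. z d \<partial>gauss D) = 0"
  using integral_gauss_component[of d "\<lambda>x. x"] integral_std_normal_distribution_moment_odd[of 1] by simp

lemma
  assumes d: "d \<in> D" "e \<in> D"
  shows integrable_gauss_mult: "integrable (gauss D) (\<lambda>z. z d * z e)"
    and integral_gauss_mult: "(\<integral>z. z d * z e \<partial>gauss D) = (if d = e then 1 else 0)"
proof -
  have "integrable (gauss D) (\<lambda>z. z d * z e) \<and> (\<integral>z. z d * z e \<partial>gauss D) = (if d = e then 1 else 0)"
  proof (cases "d = e")
    case True
    with d integral_gauss_component[of d "\<lambda>x. x^2"] integrable_gauss_component[of d "\<lambda>x. x^2"]
      std_normal_distribution_even_moments[of 1]
    show ?thesis by (simp add: power2_eq_square)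
  next
    case False
    \<comment> \<open>Padding with the constant 1 turns \<open>z d * z e\<close> into a product over
      all of \<open>D\<close>, to which the product integral applies; the factor at \<open>d\<close>
      then has mean zero.\<close>
    define f :: "'d \<Rightarrow> real \<Rightarrow> real" where "f i x = (if i \<in> {d, e} then x else 1)" for i x
    have f: "integrable std_normal_distribution (f i)" for i
      using integrable_std_normal_distribution_moment[of 1] by (cases "i \<in> {d, e}") (auto simp: f_def[abs_def])
    have "(\<Prod>i\<in>D. f i (z i)) = (\<Prod>i\<in>{d, e}. f i (z i))" for z
      using d D by (intro prod.mono_neutral_right) (auto simp: f_def)
    then have eq: "(\<Prod>i\<in>D. f i (z i)) = z d * z e" for z
      using False by (simp add: f_def)
    have "(\<Prod>i\<in>D. integral\<^sup>L std_normal_distribution (f i)) = 0"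
      using D d integral_std_normal_distribution_moment_odd[of 1]
      by (intro prod_zero bexI[of _ d]) (auto simp: f_def[abs_def])
    with P.product_integral_prod[OF D, of f, OF f] P.product_integrable_prod[OF D, of f, OF f] False show ?thesis
      by (simp add: eq)
  qed
  then show "integrable (gauss D) (\<lambda>z. z d * z e)" "(\<integral>z. z d * z e \<partial>gauss D) = (if d = e then 1 else 0)"
    by auto
qed

lemma integrable_gauss_linear: "integrable (gauss D) (\<lambda>z. \<Sum>d\<in>D. c d * z d)"
  by (intro Bochner_Integration.integrable_sum integrable_mult_right integrable_gauss_id)

lemma integral_gauss_linear: "(\<integral>z. (\<Sum>d\<in>D. c d * z d) \<partial>gauss D) = 0"
  by (subst Bochner_Integration.integral_sum) (auto simp: integrable_gauss_id integral_gauss_id)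

lemma
  shows integrable_gauss_linear_power2: "integrable (gauss D) (\<lambda>z. (\<Sum>d\<in>D. c d * z d)^2)"
    and integral_gauss_linear_power2: "(\<integral>z. (\<Sum>d\<in>D. c d * z d)^2 \<partial>gauss D) = (\<Sum>d\<in>D. (c d)^2)"
proof -
  have eq: "(\<Sum>d\<in>D. c d * z d)^2 = (\<Sum>d\<in>D. \<Sum>e\<in>D. (c d * c e) * (z d * z e))" for z :: "'d \<Rightarrow> real"
    by (simp add: power2_eq_square sum_product mult_ac)
  show "integrable (gauss D) (\<lambda>z. (\<Sum>d\<in>D. c d * z d)^2)"
    unfolding eq by (intro Bochner_Integration.integrable_sum integrable_mult_right integrable_gauss_mult)
  show "(\<integral>z. (\<Sum>d\<in>D. c d * z d)^2 \<partial>gauss D) = (\<Sum>d\<in>D. (c d)^2)"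
    unfolding eq using D
    by (simp add: Bochner_Integration.integral_sum integrable_gauss_mult integral_gauss_mult
        if_distrib power2_eq_square cong: if_cong)
qed

lemma integrable_gauss_sum_abs_power: "integrable (gauss D) (\<lambda>z. (\<Sum>d\<in>D. \<bar>z d\<bar>) ^ k)"
proof (rule Bochner_Integration.integrable_bound)
  \<comment> \<open>The dominating function comes from bounding the sum by \<open>card D\<close>
    times its largest term. The extra 1 covers empty \<open>D\<close> with \<open>k = 0\<close>,
    where the power is \<open>0 ^ 0 = 1\<close>.\<close>
  show "integrable (gauss D) (\<lambda>z. real (card D) ^ k * (\<Sum>d\<in>D. \<bar>z d\<bar> ^ k) + (if D = {} then 1 else 0))"
    by (intro Bochner_Integration.integrable_add Bochner_Integration.integrable_sum integrable_mult_right
        integrable_gauss_abs_power) auto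
  show "AE z in gauss D. norm ((\<Sum>d\<in>D. \<bar>z d\<bar>) ^ k) \<le> norm (real (card D) ^ k * (\<Sum>d\<in>D. \<bar>z d\<bar> ^ k) + (if D = {} then 1 else 0))"
  proof (rule AE_I2)
    fix z :: "'d \<Rightarrow> real"
    show "norm ((\<Sum>d\<in>D. \<bar>z d\<bar>) ^ k) \<le> norm (real (card D) ^ k * (\<Sum>d\<in>D. \<bar>z d\<bar> ^ k) + (if D = {} then 1 else 0))"
    proof (cases "D = {}")
      case False
      define m where "m = Max ((\<lambda>d. \<bar>z d\<bar>) ` D)"
      have "m \<in> (\<lambda>d. \<bar>z d\<bar>) ` D" unfolding m_def using D False by (intro Max_in) auto
      then obtain d where d: "d \<in> D" "m = \<bar>z d\<bar>" by auto
      have "(\<Sum>d\<in>D. \<bar>z d\<bar>) \<le> real (card D) * m"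
        using D by (intro sum_bounded_above) (auto simp: m_def)
      then have "(\<Sum>d\<in>D. \<bar>z d\<bar>) ^ k \<le> (real (card D) * m) ^ k"
        by (intro power_mono) (auto intro: sum_nonneg)
      also have "\<dots> = real (card D) ^ k * \<bar>z d\<bar> ^ k" by (simp add: d power_mult_distrib)
      also have "\<dots> \<le> real (card D) ^ k * (\<Sum>d\<in>D. \<bar>z d\<bar> ^ k)"
        using D d by (intro mult_left_mono member_le_sum[of d D "\<lambda>d. \<bar>z d\<bar> ^ k"]) auto
      finally show ?thesis using False
        by (simp add: abs_of_nonneg sum_nonneg)
    qed (simp add: power_0_left)
  qed
qed measurable

end

section \<open>Gaussian expectations of log-sum-exp\<close>

definition lse :: "'t set \<Rightarrow> ('t \<Rightarrow> real) \<Rightarrow> real" where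
  "lse T v = ln (\<Sum>x\<in>T. exp (v x))"

lemma lse_cong: "(\<And>x. x \<in> T \<Longrightarrow> v x = w x) \<Longrightarrow> lse T v = lse T w"
  by (simp add: lse_def)

lemma abs_lse_le:
  assumes T: "finite T" "T \<noteq> {}"
  shows "\<bar>lse T v\<bar> \<le> ln (card T) + (\<Sum>x\<in>T. \<bar>v x\<bar>)"
proof -
  define B where "B = (\<Sum>x\<in>T. \<bar>v x\<bar>)"
  have B: "\<bar>v x\<bar> \<le> B" if "x \<in> T" for x
    unfolding B_def using T that by (intro member_le_sum[of x T "\<lambda>x. \<bar>v x\<bar>"]) auto
  have c: "0 < card T" using T by (simp add: card_gt_0_iff)
  have u: "(\<Sum>x\<in>T. exp (v x)) \<le> card T * exp B"
    using B by (intro sum_bounded_above) (auto dest: abs_le_D1)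
  have l: "card T * exp (-B) \<le> (\<Sum>x\<in>T. exp (v x))"
    using B by (intro sum_bounded_below) (force simp: abs_le_iff)
  have pos: "0 < (\<Sum>x\<in>T. exp (v x))" using T by (intro sum_pos) auto
  have "lse T v \<le> ln (card T * exp B)" unfolding lse_def using u c pos by (subst ln_le_cancel_iff) auto
  moreover have "ln (card T * exp (-B)) \<le> lse T v" unfolding lse_def using l c pos by (subst ln_le_cancel_iff) auto
  moreover have l0: "0 \<le> ln (card T)" using c by simp
  ultimately have "\<bar>lse T v\<bar> \<le> ln (card T) + B" using c by (simp add: ln_mult abs_le_iff) (use l0 in linarith)
  then show ?thesis by (simp add: B_def)
qed

lemma (in finite_measure) integrable_lse:
  assumes T: "finite T" "T \<noteq> {}" and u: "\<And>x. x \<in> T \<Longrightarrow> integrable M (\<lambda>z. u z x)"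
  shows "integrable M (\<lambda>z. lse T (u z))"
proof (rule Bochner_Integration.integrable_bound)
  show "integrable M (\<lambda>z. ln (card T) + (\<Sum>x\<in>T. \<bar>u z x\<bar>))"
    by (intro Bochner_Integration.integrable_add Bochner_Integration.integrable_sum integrable_abs u integrable_const)
  show "(\<lambda>z. lse T (u z)) \<in> borel_measurable M"
    unfolding lse_def using u by (intro borel_measurable_ln borel_measurable_sum borel_measurable_exp) auto
  show "AE z in M. norm (lse T (u z)) \<le> norm (ln (card T) + (\<Sum>x\<in>T. \<bar>u z x\<bar>))"
    using abs_lse_le[OF T] by (intro AE_I2) (auto intro: order_trans[OF _ abs_ge_self])
qed

context
  fixes D :: "'d set" and T :: "'t set" and e :: "'d \<Rightarrow> 't \<Rightarrow> real"
  assumes D: "finite D" and T: "finite T" "T \<noteq> {}"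
begin

interpretation N: real_distribution std_normal_distribution by (rule real_dist_normal_dist)
interpretation P: product_prob_space "\<lambda>_. std_normal_distribution" D ..
interpretation PP: pair_prob_space "gauss D" "gauss D" ..

lemma integrable_lse_gauss:
  "integrable (gauss D) (\<lambda>z. lse T (\<lambda>x. v x + (\<Sum>d\<in>D. c d * z d * e d x)))"
proof (rule P.P.integrable_lse[OF T])
  fix x
  show "integrable (gauss D) (\<lambda>z. v x + (\<Sum>d\<in>D. c d * z d * e d x))"
    using integrable_gauss_linear[OF D, of "\<lambda>d. c d * e d x"]
    by (intro Bochner_Integration.integrable_add) (auto simp: mult_ac)
qed

text \<open>Equality in law from \<open>distr_gauss_add\<close>, followed by Fubini. It allows a
  Taylor expansion in the inner vector \<open>z'\<close> while the outer vector \<open>z\<close> is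
  frozen.\<close>

lemma
  assumes c: "\<And>d. d \<in> D \<Longrightarrow> (c d)^2 = (a d)^2 + (b d)^2"
  shows integral_lse_gauss_add: "(\<integral>z. lse T (\<lambda>x. \<Sum>d\<in>D. c d * z d * e d x) \<partial>gauss D)
      = (\<integral>z. \<integral>z'. lse T (\<lambda>x. (\<Sum>d\<in>D. a d * z d * e d x) + (\<Sum>d\<in>D. b d * z' d * e d x)) \<partial>gauss D \<partial>gauss D)" (is ?eq)
    and integrable_lse_gauss_add: "integrable (gauss D)
      (\<lambda>z. \<integral>z'. lse T (\<lambda>x. (\<Sum>d\<in>D. a d * z d * e d x) + (\<Sum>d\<in>D. b d * z' d * e d x)) \<partial>gauss D)" (is ?int)
proof -
  \<comment> \<open>Both integrands are the same functional \<open>F\<close>, evaluated at the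
    vectors \<open>C z\<close> and \<open>A (z, z')\<close>, which have the same law.\<close>
  define F where "F y = lse T (\<lambda>x. \<Sum>d\<in>D. y d * e d x)" for y
  define A where "A p = (case p of (z, z') \<Rightarrow> \<lambda>d\<in>D. a d * z d + b d * z' d)" for p :: "('d \<Rightarrow> real) \<times> ('d \<Rightarrow> real)"
  define C where "C z = (\<lambda>d\<in>D. c d * z d)" for z :: "'d \<Rightarrow> real"
  have F[measurable]: "F \<in> borel_measurable (PiM D (\<lambda>_. borel))"
    unfolding F_def[abs_def] lse_def by measurable
  have A[measurable]: "A \<in> gauss D \<Otimes>\<^sub>M gauss D \<rightarrow>\<^sub>M PiM D (\<lambda>_. borel)"
    unfolding A_def[abs_def] by measurable
  have C[measurable]: "C \<in> gauss D \<rightarrow>\<^sub>M PiM D (\<lambda>_. borel)"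
    unfolding C_def[abs_def] by measurable
  have eq: "distr (gauss D \<Otimes>\<^sub>M gauss D) (PiM D (\<lambda>_. borel)) A = distr (gauss D) (PiM D (\<lambda>_. borel)) C"
    unfolding A_def[abs_def] C_def[abs_def] by (rule distr_gauss_add[OF D c])
  have FC: "F (C z) = lse T (\<lambda>x. \<Sum>d\<in>D. c d * z d * e d x)" for z
    by (simp add: F_def C_def)
  have FA: "F (A (z, z')) = lse T (\<lambda>x. (\<Sum>d\<in>D. a d * z d * e d x) + (\<Sum>d\<in>D. b d * z' d * e d x))" for z z'
    by (simp add: F_def A_def distrib_right sum.distrib)
  have "integrable (gauss D) (\<lambda>z. F (C z))"
    unfolding FC using integrable_lse_gauss[of "\<lambda>_. 0" c] by simp
  then have "integrable (distr (gauss D) (PiM D (\<lambda>_. borel)) C) F"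
    by (subst integrable_distr_eq) auto
  then have int: "integrable (gauss D \<Otimes>\<^sub>M gauss D) (\<lambda>p. F (A p))"
    unfolding eq[symmetric] by (subst (asm) integrable_distr_eq) auto
  have "(\<integral>z. F (C z) \<partial>gauss D) = (\<integral>p. F (A p) \<partial>(gauss D \<Otimes>\<^sub>M gauss D))"
    by (subst (1 2) integral_distr[symmetric, where N = "PiM D (\<lambda>_. borel)"]) (auto simp: eq)
  also have "\<dots> = (\<integral>z. \<integral>z'. F (A (z, z')) \<partial>gauss D \<partial>gauss D)"
    using PP.integral_fst'[OF int] by simp
  finally show ?eq by (simp add: FC FA)
  show ?int using PP.integrable_fst'[OF int] by (simp add: FA)
qed

text \<open>Integrate the pointwise Taylor estimate: the linear term has mean zero, the squared
  increments integrate to sums of squared coefficients, and \<open>K\<close> times the sum of the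
  \<open>\<bar>z d\<bar>\<close> serves as the bound \<open>W\<close> in the cubic
  remainder.\<close>

lemma integral_lse_gauss_Taylor:
  fixes v :: "'t \<Rightarrow> real"
  assumes r: "0 \<le> r" and K: "\<And>d x. d \<in> D \<Longrightarrow> x \<in> T \<Longrightarrow> \<bar>s d * e d x\<bar> \<le> K"
  defines "p \<equiv> \<lambda>x. exp (v x) / (\<Sum>x\<in>T. exp (v x))"
  shows "\<bar>(\<integral>z. lse T (\<lambda>x. v x + (\<Sum>d\<in>D. r * s d * z d * e d x)) \<partial>gauss D)
      - (lse T v + r^2 / 4 * (\<Sum>x\<in>T. \<Sum>y\<in>T. p x * p y * (\<Sum>d\<in>D. (s d * (e d x - e d y))^2)))\<bar>
    \<le> r^3 * (\<integral>z. (K * (\<Sum>d\<in>D. \<bar>z d\<bar>))^3 \<partial>gauss D)"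
proof -
  define w where "w z x = (\<Sum>d\<in>D. (s d * e d x) * z d)" for z x
  \<comment> \<open>The Taylor remainder, whose integral isolates the difference to be
    bounded.\<close>
  define R where "R z = lse T (\<lambda>x. v x + r * w z x) - lse T v - r * (\<Sum>x\<in>T. p x * w z x)
      - r^2 / 4 * (\<Sum>x\<in>T. \<Sum>y\<in>T. p x * p y * (w z x - w z y)^2)" for z
  have wd: "w z x - w z y = (\<Sum>d\<in>D. (s d * (e d x - e d y)) * z d)" for z x y
    by (simp add: w_def sum_subtractf[symmetric] algebra_simps)
  have rw: "r * w z x = (\<Sum>d\<in>D. r * s d * z d * e d x)" for z x
    by (simp add: w_def sum_distrib_left mult_ac)
  have I1: "integrable (gauss D) (\<lambda>z. lse T (\<lambda>x. v x + r * w z x))"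
    using integrable_lse_gauss[of v "\<lambda>d. r * s d"] by (simp add: rw)
  have I2: "integrable (gauss D) (\<lambda>z. w z x)" for x
    unfolding w_def by (rule integrable_gauss_linear[OF D])
  have I3: "integrable (gauss D) (\<lambda>z. (w z x - w z y)^2)" for x y
    unfolding wd by (rule integrable_gauss_linear_power2[OF D])
  have E2: "(\<integral>z. w z x \<partial>gauss D) = 0" for x
    unfolding w_def by (rule integral_gauss_linear[OF D])
  have E3: "(\<integral>z. (w z x - w z y)^2 \<partial>gauss D) = (\<Sum>d\<in>D. (s d * (e d x - e d y))^2)" for x y
    unfolding wd by (rule integral_gauss_linear_power2[OF D])
  have IK: "integrable (gauss D) (\<lambda>z. r^3 * (K * (\<Sum>d\<in>D. \<bar>z d\<bar>))^3)"
    using integrable_gauss_sum_abs_power[OF D, of 3] by (simp add: power_mult_distrib)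
  have b: "\<bar>R z\<bar> \<le> r^3 * (K * (\<Sum>d\<in>D. \<bar>z d\<bar>))^3" for z
  proof -
    have "\<bar>w z x\<bar> \<le> K * (\<Sum>d\<in>D. \<bar>z d\<bar>)" if "x \<in> T" for x
      unfolding w_def sum_distrib_left
      by (rule order_trans[OF sum_abs]) (auto simp: abs_mult[of _ "z _"] intro!: sum_mono mult_right_mono K that)
    from ln_sum_exp_Taylor[OF T r this] show ?thesis
      unfolding R_def lse_def p_def by simp
  qed
  have IR: "integrable (gauss D) R"
    unfolding R_def[abs_def] by (intro Bochner_Integration.integrable_diff I1 integrable_mult_right
        Bochner_Integration.integrable_sum I2 I3) simp
  have "(\<integral>z. R z \<partial>gauss D) = (\<integral>z. lse T (\<lambda>x. v x + r * w z x) \<partial>gauss D) - lse T v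
     - r^2 / 4 * (\<Sum>x\<in>T. \<Sum>y\<in>T. p x * p y * (\<Sum>d\<in>D. (s d * (e d x - e d y))^2))"
    unfolding R_def
    by (simp add: Bochner_Integration.integral_diff Bochner_Integration.integral_sum
        Bochner_Integration.integrable_diff Bochner_Integration.integrable_sum I1 I2 I3 E2 E3 P.P.prob_space)
  moreover have "\<bar>\<integral>z. R z \<partial>gauss D\<bar> \<le> (\<integral>z. r^3 * (K * (\<Sum>d\<in>D. \<bar>z d\<bar>))^3 \<partial>gauss D)"
    by (rule order_trans[OF integral_abs_bound integral_mono[OF integrable_abs[OF IR] IK b]])
  ultimately show ?thesis by (simp add: rw algebra_simps)
qed

text \<open>Conditioned on the common part with scales \<open>a\<close>, replacing the small part
  \<open>r * s\<close> by \<open>r * t\<close> keeps the zeroth and first order terms. The second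
  order term does not decrease, because the Gibbs weights are nonnegative and \<open>incr\<close>
  holds. What is lost is at most one cubic remainder on each side.\<close>

lemma integral_lse_gauss_step:
  assumes r: "0 \<le> r"
    and K: "\<And>d x. d \<in> D \<Longrightarrow> x \<in> T \<Longrightarrow> \<bar>s d * e d x\<bar> \<le> K" "\<And>d x. d \<in> D \<Longrightarrow> x \<in> T \<Longrightarrow> \<bar>t d * e d x\<bar> \<le> K"
    and incr: "\<And>x y. x \<in> T \<Longrightarrow> y \<in> T \<Longrightarrow>
      (\<Sum>d\<in>D. (s d * (e d x - e d y))^2) \<le> (\<Sum>d\<in>D. (t d * (e d x - e d y))^2)"
    and c1: "\<And>d. d \<in> D \<Longrightarrow> (c1 d)^2 = (a d)^2 + (r * s d)^2"
    and c2: "\<And>d. d \<in> D \<Longrightarrow> (c2 d)^2 = (a d)^2 + (r * t d)^2"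
  shows "(\<integral>z. lse T (\<lambda>x. \<Sum>d\<in>D. c1 d * z d * e d x) \<partial>gauss D)
    \<le> (\<integral>z. lse T (\<lambda>x. \<Sum>d\<in>D. c2 d * z d * e d x) \<partial>gauss D)
      + r^3 * (2 * (\<integral>z. (K * (\<Sum>d\<in>D. \<bar>z d\<bar>))^3 \<partial>gauss D))"
proof -
  define I where "I q v = (\<integral>z. lse T (\<lambda>x. v x + (\<Sum>d\<in>D. r * q d * z d * e d x)) \<partial>gauss D)" for q v
  define J where "J = (\<integral>z. (K * (\<Sum>d\<in>D. \<bar>z d\<bar>))^3 \<partial>gauss D)"
  have le: "I s v \<le> I t v + r^3 * (2 * J)" for v
  proof -
    define p where "p x = exp (v x) / (\<Sum>x\<in>T. exp (v x))" for x
    have p0: "0 \<le> p x" for x by (simp add: p_def sum_nonneg)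
    have "r^2 / 4 * (\<Sum>x\<in>T. \<Sum>y\<in>T. p x * p y * (\<Sum>d\<in>D. (s d * (e d x - e d y))^2))
       \<le> r^2 / 4 * (\<Sum>x\<in>T. \<Sum>y\<in>T. p x * p y * (\<Sum>d\<in>D. (t d * (e d x - e d y))^2))"
      by (intro mult_left_mono sum_mono incr) (auto simp: p0)
    with integral_lse_gauss_Taylor[OF r K(1), of v, folded p_def I_def J_def]
         integral_lse_gauss_Taylor[OF r K(2), of v, folded p_def I_def J_def]
    show ?thesis by (simp add: abs_le_iff)
  qed
  have eq1: "(\<integral>z. lse T (\<lambda>x. \<Sum>d\<in>D. c1 d * z d * e d x) \<partial>gauss D) = (\<integral>z. I s (\<lambda>x. \<Sum>d\<in>D. a d * z d * e d x) \<partial>gauss D)"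
    and eq2: "(\<integral>z. lse T (\<lambda>x. \<Sum>d\<in>D. c2 d * z d * e d x) \<partial>gauss D) = (\<integral>z. I t (\<lambda>x. \<Sum>d\<in>D. a d * z d * e d x) \<partial>gauss D)"
    using integral_lse_gauss_add[OF c1] integral_lse_gauss_add[OF c2] by (simp_all add: I_def)
  have i1: "integrable (gauss D) (\<lambda>z. I s (\<lambda>x. \<Sum>d\<in>D. a d * z d * e d x))"
    and i2: "integrable (gauss D) (\<lambda>z. I t (\<lambda>x. \<Sum>d\<in>D. a d * z d * e d x))"
    using integrable_lse_gauss_add[OF c1] integrable_lse_gauss_add[OF c2] by (simp_all add: I_def)
  have "(\<integral>z. I s (\<lambda>x. \<Sum>d\<in>D. a d * z d * e d x) \<partial>gauss D)
     \<le> (\<integral>z. I t (\<lambda>x. \<Sum>d\<in>D. a d * z d * e d x) + r^3 * (2 * J) \<partial>gauss D)"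
    by (intro integral_mono i1 Bochner_Integration.integrable_add i2 le) simp
  also have "\<dots> = (\<integral>z. I t (\<lambda>x. \<Sum>d\<in>D. a d * z d * e d x) \<partial>gauss D) + r^3 * (2 * J)"
    using i2 by (simp add: P.P.prob_space)
  finally show ?thesis unfolding eq1 eq2 J_def .
qed

text \<open>Telescope over \<open>n\<close> swaps of size \<open>r = 1 / sqrt n\<close>. Each costs
  \<open>C * r^3\<close>, so the total is \<open>C / sqrt n\<close>, which vanishes as
  \<open>n\<close> grows while the two end points stay fixed.\<close>

lemma integral_lse_gauss_mono:
  assumes s: "\<And>d. d \<in> D \<Longrightarrow> 0 \<le> s d" and t: "\<And>d. d \<in> D \<Longrightarrow> 0 \<le> t d"
    and incr: "\<And>x y. x \<in> T \<Longrightarrow> y \<in> T \<Longrightarrow>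
      (\<Sum>d\<in>D. (s d * (e d x - e d y))^2) \<le> (\<Sum>d\<in>D. (t d * (e d x - e d y))^2)"
  shows "(\<integral>z. lse T (\<lambda>x. \<Sum>d\<in>D. s d * z d * e d x) \<partial>gauss D)
    \<le> (\<integral>z. lse T (\<lambda>x. \<Sum>d\<in>D. t d * z d * e d x) \<partial>gauss D)"
proof -
  define \<Phi> where "\<Phi> c = (\<integral>z. lse T (\<lambda>x. \<Sum>d\<in>D. c d * z d * e d x) \<partial>gauss D)" for c
  define K where "K = (\<Sum>d\<in>D. \<Sum>x\<in>T. \<bar>s d * e d x\<bar> + \<bar>t d * e d x\<bar>)"
  define C where "C = 2 * (\<integral>z. (K * (\<Sum>d\<in>D. \<bar>z d\<bar>))^3 \<partial>gauss D)"
  have K: "\<bar>s d * e d x\<bar> + \<bar>t d * e d x\<bar> \<le> K" if "d \<in> D" "x \<in> T" for d x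
  proof -
    have "\<bar>s d * e d x\<bar> + \<bar>t d * e d x\<bar> \<le> (\<Sum>x\<in>T. \<bar>s d * e d x\<bar> + \<bar>t d * e d x\<bar>)"
      using T that by (intro member_le_sum[of x T "\<lambda>x. \<bar>s d * e d x\<bar> + \<bar>t d * e d x\<bar>"]) auto
    also have "\<dots> \<le> K"
      unfolding K_def using D that
      by (intro member_le_sum[of d D "\<lambda>d. \<Sum>x\<in>T. \<bar>s d * e d x\<bar> + \<bar>t d * e d x\<bar>"]) (auto intro: sum_nonneg)
    finally show ?thesis .
  qed
  have Ks: "\<bar>s d * e d x\<bar> \<le> K" and Kt: "\<bar>t d * e d x\<bar> \<le> K" if "d \<in> D" "x \<in> T" for d x
    using K[OF that] by auto
  have main: "\<Phi> s \<le> \<Phi> t + C * (1 / sqrt (real n))" if n: "1 \<le> n" for n :: nat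
  proof -
    \<comment> \<open>linear interpolation of the variances: \<open>c 0 = s\<close>, \<open>c n = t\<close>\<close>
    define c where "c k d = sqrt ((real (n - k) * (s d)^2 + real k * (t d)^2) / real n)" for k d
    have sq: "(sqrt ((real i * (s d)^2 + real j * (t d)^2) / real n))^2 = (real i * (s d)^2 + real j * (t d)^2) / real n"
      for i j d by (intro real_sqrt_pow2) (auto intro!: divide_nonneg_nonneg add_nonneg_nonneg)
    \<comment> \<open>The shared part has variance \<open>((n - k - 1) * s^2 + k * t^2) / n\<close>
      in each coordinate. Adding \<open>s^2 / n\<close> gives the variance of \<open>c k\<close>,
      and adding \<open>t^2 / n\<close> gives that of \<open>c (Suc k)\<close>.\<close>
    have step: "\<Phi> (c k) \<le> \<Phi> (c (Suc k)) + (1 / sqrt (real n))^3 * C" if k: "k < n" for k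
      unfolding \<Phi>_def C_def
    proof (rule integral_lse_gauss_step[where s = s and t = t and a = "\<lambda>d. sqrt ((real (n - Suc k) * (s d)^2 + real k * (t d)^2) / real n)"])
      show "(c k d)^2 = (sqrt ((real (n - Suc k) * (s d)^2 + real k * (t d)^2) / real n))^2 + (1 / sqrt (real n) * s d)^2" for d
        unfolding c_def sq using k by (simp add: power_mult_distrib power_divide of_nat_diff field_simps)
      show "(c (Suc k) d)^2 = (sqrt ((real (n - Suc k) * (s d)^2 + real k * (t d)^2) / real n))^2 + (1 / sqrt (real n) * t d)^2" for d
        unfolding c_def sq using k by (simp add: power_mult_distrib power_divide of_nat_diff field_simps)
    qed (auto intro: incr Ks Kt)
    have "\<Phi> (c 0) \<le> \<Phi> (c k) + real k * ((1 / sqrt (real n))^3 * C)" if "k \<le> n" for k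
      using that
    proof (induction k)
      case (Suc k)
      with step[of k] show ?case by (simp add: algebra_simps)
    qed simp
    from this[of n] have "\<Phi> (c 0) \<le> \<Phi> (c n) + real n * ((1 / sqrt (real n))^3 * C)" by simp
    also have "real n * ((1 / sqrt (real n))^3 * C) = C * (1 / sqrt (real n))"
      using n by (simp add: power3_eq_cube field_simps)
    finally have "\<Phi> (c 0) \<le> \<Phi> (c n) + C * (1 / sqrt (real n))" .
    \<comment> \<open>The square roots return absolute values, so the signs of \<open>s\<close> and
      \<open>t\<close> are used here.\<close>
    moreover have "\<Phi> (c 0) = \<Phi> s" "\<Phi> (c n) = \<Phi> t"
      using n s t by (auto simp: \<Phi>_def c_def real_sqrt_divide real_sqrt_mult intro!: Bochner_Integration.integral_cong lse_cong sum.cong)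
    ultimately show ?thesis by simp
  qed
  have "(\<lambda>n. \<Phi> t + C * (1 / sqrt (real n))) \<longlonglongrightarrow> \<Phi> t + C * 0"
    using tendsto_real_sqrt[OF lim_1_over_n] by (intro tendsto_intros) (simp add: real_sqrt_divide)
  then have "\<Phi> s \<le> \<Phi> t + C * 0"
    by (rule LIMSEQ_le_const) (use main in auto)
  then show ?thesis by (simp add: \<Phi>_def)
qed

end

section \<open>From log-sum-exp to the maximum\<close>

lemma
  fixes v :: "'t \<Rightarrow> real"
  assumes T: "finite T" "T \<noteq> {}"
  shows Max_le_lse: "Max (v ` T) \<le> lse T v"
    and lse_le_Max: "lse T v \<le> Max (v ` T) + ln (card T)"
proof -
  have c: "0 < card T" using T by (simp add: card_gt_0_iff)
  have pos: "0 < (\<Sum>x\<in>T. exp (v x))" using T by (intro sum_pos) auto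
  have "Max (v ` T) \<in> v ` T" using T by (intro Max_in) auto
  then obtain x where x: "x \<in> T" "Max (v ` T) = v x" by auto
  have "exp (v x) \<le> (\<Sum>x\<in>T. exp (v x))" using T x by (intro member_le_sum[of x T "\<lambda>x. exp (v x)"]) auto
  then show "Max (v ` T) \<le> lse T v" unfolding lse_def x(2) using pos by (subst ln_ge_iff) auto
  have "(\<Sum>x\<in>T. exp (v x)) \<le> card T * exp (Max (v ` T))"
    using T by (intro sum_bounded_above) auto
  then have "lse T v \<le> ln (card T * exp (Max (v ` T)))" unfolding lse_def using c pos by (subst ln_le_cancel_iff) auto
  then show "lse T v \<le> Max (v ` T) + ln (card T)" using c by (simp add: ln_mult)
qed

lemma integrable_Max:
  fixes f :: "'i \<Rightarrow> 'a \<Rightarrow> real"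
  assumes T: "finite T" "T \<noteq> {}" and f: "\<And>x. x \<in> T \<Longrightarrow> integrable M (f x)"
  shows "integrable M (\<lambda>z. Max ((\<lambda>x. f x z) ` T))"
proof (rule Bochner_Integration.integrable_bound)
  show "integrable M (\<lambda>z. \<Sum>x\<in>T. \<bar>f x z\<bar>)"
    by (intro Bochner_Integration.integrable_sum integrable_abs f)
  show "(\<lambda>z. Max ((\<lambda>x. f x z) ` T)) \<in> borel_measurable M"
    using f T by (intro borel_measurable_Max) auto
  show "AE z in M. norm (Max ((\<lambda>x. f x z) ` T)) \<le> norm (\<Sum>x\<in>T. \<bar>f x z\<bar>)"
  proof (rule AE_I2)
    fix z
    have "Max ((\<lambda>x. f x z) ` T) \<in> (\<lambda>x. f x z) ` T" using T by (intro Max_in) auto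
    then obtain x where x: "x \<in> T" "Max ((\<lambda>x. f x z) ` T) = f x z" by auto
    have "\<bar>f x z\<bar> \<le> (\<Sum>x\<in>T. \<bar>f x z\<bar>)" using T x by (intro member_le_sum[of x T "\<lambda>x. \<bar>f x z\<bar>"]) auto
    then show "norm (Max ((\<lambda>x. f x z) ` T)) \<le> norm (\<Sum>x\<in>T. \<bar>f x z\<bar>)"
      unfolding x(2) by simp
  qed
qed

text \<open>At inverse temperature \<open>n\<close>, log-sum-exp exceeds \<open>n\<close> times the
  maximum by at most \<open>ln (card T)\<close>, whatever the values are. Dividing by
  \<open>n\<close> and letting \<open>n\<close> grow removes this gap. The increment condition is
  homogeneous, so it survives the scaling.\<close>

lemma integral_Max_gauss_mono:
  assumes D: "finite D" and T: "finite T" "T \<noteq> {}"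
    and s: "\<And>d. d \<in> D \<Longrightarrow> 0 \<le> s d" and t: "\<And>d. d \<in> D \<Longrightarrow> 0 \<le> t d"
    and incr: "\<And>x y. x \<in> T \<Longrightarrow> y \<in> T \<Longrightarrow>
      (\<Sum>d\<in>D. (s d * (e d x - e d y))^2) \<le> (\<Sum>d\<in>D. (t d * (e d x - e d y))^2)"
  shows "(\<integral>z. Max ((\<lambda>x. \<Sum>d\<in>D. s d * z d * e d x) ` T) \<partial>gauss D)
    \<le> (\<integral>z. Max ((\<lambda>x. \<Sum>d\<in>D. t d * z d * e d x) ` T) \<partial>gauss D)"
proof -
  interpret G: prob_space "gauss D"
    by (rule prob_space_PiM) (use real_dist_normal_dist in \<open>simp add: real_distribution_def\<close>)
  define X where "X q z x = (\<Sum>d\<in>D. q d * z d * e d x)" for q z x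
  define E where "E q = (\<integral>z. Max (X q z ` T) \<partial>gauss D)" for q
  have iX: "integrable (gauss D) (\<lambda>z. X q z x)" for q x
    using integrable_gauss_linear[OF D, of "\<lambda>d. q d * e d x"] by (simp add: X_def mult_ac)
  have iM: "integrable (gauss D) (\<lambda>z. Max (X q z ` T))" for q
    by (rule integrable_Max[OF T iX])
  have "E s \<le> E t + ln (card T) * (1 / real n)" if n: "1 \<le> n" for n
  proof -
    \<comment> \<open>Multiplication by a nonnegative factor is monotone and therefore commutes with
      \<open>Max\<close>.\<close>
    have nM: "real n * Max (X q z ` T) = Max ((\<lambda>x. real n * X q z x) ` T)" for q z
      using T mono_Max_commute[of "\<lambda>x. real n * x" "X q z ` T"]
      by (simp add: image_image mono_def mult_left_mono)
    have nX: "real n * X q z x = (\<Sum>d\<in>D. q d * z d * (real n * e d x))" for q z x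
      by (simp add: X_def sum_distrib_left mult_ac)
    have iL: "integrable (gauss D) (\<lambda>z. lse T (\<lambda>x. real n * X q z x))" for q
      by (intro G.integrable_lse[OF T] integrable_mult_right iX)
    have "real n * E s = (\<integral>z. Max ((\<lambda>x. real n * X s z x) ` T) \<partial>gauss D)"
      by (simp add: E_def flip: nM)
    also have "\<dots> \<le> (\<integral>z. lse T (\<lambda>x. real n * X s z x) \<partial>gauss D)"
      using iM by (intro integral_mono iL Max_le_lse T) (simp add: flip: nM)
    also have "\<dots> \<le> (\<integral>z. lse T (\<lambda>x. real n * X t z x) \<partial>gauss D)"
      unfolding nX
    proof (rule integral_lse_gauss_mono[OF D T s t])
      fix x y assume xy: "x \<in> T" "y \<in> T"
      have *: "(\<Sum>d\<in>D. (q d * (real n * e d x - real n * e d y))\<^sup>2) = (real n)^2 * (\<Sum>d\<in>D. (q d * (e d x - e d y))^2)" for q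
        by (simp add: sum_distrib_left power2_eq_square algebra_simps)
      show "(\<Sum>d\<in>D. (s d * (real n * e d x - real n * e d y))\<^sup>2) \<le> (\<Sum>d\<in>D. (t d * (real n * e d x - real n * e d y))\<^sup>2)"
        unfolding * by (intro mult_left_mono incr xy) simp
    qed auto
    also have "\<dots> \<le> (\<integral>z. Max ((\<lambda>x. real n * X t z x) ` T) + ln (card T) \<partial>gauss D)"
      using iM by (intro integral_mono iL lse_le_Max T) (simp add: flip: nM)
    also have "\<dots> = real n * E t + ln (card T)"
      using iM[of t] by (simp add: E_def G.prob_space flip: nM)
    finally show ?thesis using n by (simp add: field_simps)
  qed
  moreover have "(\<lambda>n. E t + ln (card T) * (1 / real n)) \<longlonglongrightarrow> E t + ln (card T) * 0"
    by (intro tendsto_intros lim_1_over_n)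
  ultimately have "E s \<le> E t + ln (card T) * 0"
    by (intro LIMSEQ_le_const) auto
  then show ?thesis by (simp add: E_def X_def)
qed

section \<open>Transfer to independent normal variables on an arbitrary probability space\<close>

lemma distributed_std_normal_distr:
  assumes "distributed M lborel X std_normal_density"
  shows "distr M borel X = std_normal_distribution"
  using distributed_distr_eq_density[OF assms] by (metis distr_cong sets_lborel)

text \<open>Independence means that the joint law is the product of the marginals, here
  \<open>gauss D\<close>; the rest is change of variables.\<close>

lemma (in prob_space) integral_indep_std_normal:
  fixes V :: "'d \<Rightarrow> 'a \<Rightarrow> real" and F :: "('d \<Rightarrow> real) \<Rightarrow> real"
  assumes D: "D \<noteq> {}" and ind: "indep_vars (\<lambda>_. borel) V D"
    and V: "\<And>d. d \<in> D \<Longrightarrow> distributed M lborel (V d) std_normal_density"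
    and F: "F \<in> borel_measurable (PiM D (\<lambda>_. borel))"
  shows "expectation (\<lambda>\<omega>. F (\<lambda>d\<in>D. V d \<omega>)) = (\<integral>z. F z \<partial>gauss D)"
proof -
  have rv: "random_variable borel (V d)" if "d \<in> D" for d
    using V[OF that] by (auto dest: distributed_measurable)
  have m: "(\<lambda>\<omega>. \<lambda>d\<in>D. V d \<omega>) \<in> M \<rightarrow>\<^sub>M PiM D (\<lambda>_. borel)"
    by (intro measurable_restrict rv)
  have "distr M (PiM D (\<lambda>_. borel)) (\<lambda>\<omega>. \<lambda>d\<in>D. V d \<omega>) = PiM D (\<lambda>d. distr M borel (V d))"
    using indep_vars_iff_distr_eq_PiM'[OF D, where M' = "\<lambda>_. borel" and X = V] rv ind by simp
  also have "\<dots> = gauss D"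
    by (intro PiM_cong) (auto simp: distributed_std_normal_distr V)
  finally show ?thesis using integral_distr[OF m F] by simp
qed

text \<open>Both processes are driven by one family \<open>V\<close> with common coefficients
  \<open>e\<close> and differ only in the scales. Scales 0 and 1 can thus select which coordinates
  drive which process.\<close>

lemma (in prob_space) sudakov_fernique:
  fixes V :: "'d \<Rightarrow> 'a \<Rightarrow> real"
  assumes D: "finite D" and T: "finite T" "T \<noteq> {}"
    and ind: "indep_vars (\<lambda>_. borel) V D"
    and V: "\<And>d. d \<in> D \<Longrightarrow> distributed M lborel (V d) std_normal_density"
    and s: "\<And>d. d \<in> D \<Longrightarrow> 0 \<le> s d" and t: "\<And>d. d \<in> D \<Longrightarrow> 0 \<le> t d"
    and incr: "\<And>x y. x \<in> T \<Longrightarrow> y \<in> T \<Longrightarrow>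
      (\<Sum>d\<in>D. (s d * (e d x - e d y))^2) \<le> (\<Sum>d\<in>D. (t d * (e d x - e d y))^2)"
  shows "expectation (\<lambda>\<omega>. Max ((\<lambda>x. \<Sum>d\<in>D. s d * V d \<omega> * e d x) ` T))
    \<le> expectation (\<lambda>\<omega>. Max ((\<lambda>x. \<Sum>d\<in>D. t d * V d \<omega> * e d x) ` T))"
proof (cases "D = {}")
  case False
  have *: "expectation (\<lambda>\<omega>. Max ((\<lambda>x. \<Sum>d\<in>D. q d * V d \<omega> * e d x) ` T))
      = (\<integral>z. Max ((\<lambda>x. \<Sum>d\<in>D. q d * z d * e d x) ` T) \<partial>gauss D)" for q
  proof -
    have "(\<lambda>z. Max ((\<lambda>x. \<Sum>d\<in>D. q d * z d * e d x) ` T)) \<in> borel_measurable (PiM D (\<lambda>_. borel))"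
      using T by (intro borel_measurable_Max) auto
    from integral_indep_std_normal[OF False ind V this] show ?thesis by simp
  qed
  show ?thesis unfolding * by (rule integral_Max_gauss_mono[OF D T s t incr])
qed simp

section \<open>The random dual dominates for fixed dimension\<close>

abbreviation subsets_of_card :: "nat \<Rightarrow> nat \<Rightarrow> nat set set" where
  "subsets_of_card d k \<equiv> {I. I \<subseteq> {1..d} \<and> card I = k}"

text \<open>Equals the sum of the \<open>k\<close> largest of the entries \<open>h 1\<close> to
  \<open>h d\<close>; the form as a maximum of linear functions avoids order statistics and gives
  integrability directly.\<close>

definition top_sum :: "nat \<Rightarrow> nat \<Rightarrow> (nat \<Rightarrow> real) \<Rightarrow> real" where
  "top_sum d k h = Max ((\<lambda>I. \<Sum>i\<in>I. h i) ` subsets_of_card d k)"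

lemma finite_subsets_of_card [simp]: "finite (subsets_of_card d k)"
  by (rule finite_subset[of _ "Pow {1..d}"]) auto

lemma subsets_of_card_nonempty: "k \<le> d \<Longrightarrow> subsets_of_card d k \<noteq> {}"
  using obtain_subset_with_card_n[of k "{1..d}"] by auto

lemma sum_unit_indicator:
  fixes h :: "nat \<Rightarrow> real"
  assumes "I \<in> subsets_of_card d k"
  shows "(\<Sum>i=1..d. h i * (indicator I i / sqrt k)) = (\<Sum>i\<in>I. h i) / sqrt k"
proof -
  have "(\<Sum>i=1..d. h i * indicator I i) = (\<Sum>i\<in>I. h i)"
    using assms by (subst sum.mono_neutral_cong_right[of "{1..d}" I _ h]) auto
  then show ?thesis by (simp add: sum_divide_distrib[symmetric])
qed

lemma unit_indicator_norm:
  assumes "I \<in> subsets_of_card d k" "1 \<le> k"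
  shows "(\<Sum>i=1..d. (indicator I i / sqrt k)^2 :: real) = 1"
proof -
  have "(\<Sum>i=1..d. (indicator I i / sqrt k)^2) = (\<Sum>i=1..d. 1 / sqrt k * (indicator I i / sqrt k) :: real)"
    by (intro sum.cong) (auto simp: indicator_def power2_eq_square)
  also have "\<dots> = 1"
    using assms(2) by (subst sum_unit_indicator[OF assms(1)]) (use assms in auto)
  finally show ?thesis .
qed

text \<open>A vector with entries 0 or \<open>1 / sqrt k\<close> is determined by its support
  \<open>I\<close>, and the sum constraint reads \<open>card I / sqrt k = sqrt k\<close>, that is
  \<open>card I = k\<close>.\<close>

lemma scaled_indicators_eq:
  assumes k: "1 \<le> k"
  shows "scaled_indicators d k = (\<lambda>I. \<lambda>i\<in>{1..d}. indicator I i / sqrt k) ` subsets_of_card d k"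
proof (intro equalityI subsetI)
  fix x assume x: "x \<in> scaled_indicators d k"
  define I where "I = {i\<in>{1..d}. x i \<noteq> 0}"
  have v: "x i \<in> {0, 1 / sqrt k}" if "i \<in> {1..d}" for i
    using x that unfolding scaled_indicators_def by blast
  have xi: "x i = indicator I i / sqrt k" if "i \<in> {1..d}" for i
    using v[OF that] that by (cases "x i = 0") (auto simp: I_def)
  have "sqrt k = (\<Sum>i=1..d. x i)" using x by (simp add: scaled_indicators_def)
  also have "\<dots> = (\<Sum>i=1..d. if i \<in> I then 1 / sqrt k else 0)" using xi by (intro sum.cong) auto
  also have "\<dots> = card I / sqrt k"
    by (subst sum.inter_restrict[symmetric]) (auto simp: I_def Int_def intro!: arg_cong[where f = card])
  finally have "real (card I) = sqrt k * sqrt k" using k by (simp add: field_simps)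
  then have "card I = k" by simp
  moreover have "I \<subseteq> {1..d}" unfolding I_def by blast
  moreover have "x = (\<lambda>i\<in>{1..d}. indicator I i / sqrt k)"
    using x xi by (intro ext) (auto simp: scaled_indicators_def PiE_def extensional_def restrict_def)
  ultimately show "x \<in> (\<lambda>I. \<lambda>i\<in>{1..d}. indicator I i / sqrt k) ` subsets_of_card d k"
    by (intro image_eqI[of _ _ I]) simp_all
next
  fix x assume "x \<in> (\<lambda>I. \<lambda>i\<in>{1..d}. indicator I i / sqrt k) ` subsets_of_card d k"
  then obtain I where I: "I \<in> subsets_of_card d k" and x: "x = (\<lambda>i\<in>{1..d}. indicator I i / sqrt k)" by (elim imageE)
  have "(\<Sum>i=1..d. x i) = (\<Sum>i=1..d. 1 * (indicator I i / sqrt k))" by (simp add: x)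
  also have "\<dots> = sqrt k" unfolding sum_unit_indicator[OF I] using I by (simp add: real_div_sqrt)
  finally show "x \<in> scaled_indicators d k"
    by (auto simp: scaled_indicators_def x indicator_def)
qed

lemma random_dual_eq:
  assumes k: "1 \<le> k1" "1 \<le> k2"
  shows "random_dual m n k1 k2 h g = 1 / sqrt (real k1 * real k2) *
    Max ((\<lambda>(I, J). (\<Sum>i=1..m. h i * (indicator I i / sqrt k1)) + (\<Sum>j=1..n. g j * (indicator J j / sqrt k2)))
      ` (subsets_of_card m k1 \<times> subsets_of_card n k2))"
proof -
  have "{(\<Sum>i=1..m. h i * y i) + (\<Sum>j=1..n. g j * x j) | x y.
            x \<in> scaled_indicators n k2 \<and> y \<in> scaled_indicators m k1}
     = (\<lambda>(y, x). (\<Sum>i=1..m. h i * y i) + (\<Sum>j=1..n. g j * x j)) ` (scaled_indicators m k1 \<times> scaled_indicators n k2)"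
    by auto
  also have "\<dots> = (\<lambda>(I, J). (\<Sum>i=1..m. h i * (indicator I i / sqrt k1)) + (\<Sum>j=1..n. g j * (indicator J j / sqrt k2)))
      ` (subsets_of_card m k1 \<times> subsets_of_card n k2)"
    unfolding scaled_indicators_eq[OF k(1)] scaled_indicators_eq[OF k(2)] map_prod_image[symmetric]
      image_image
    by (intro image_cong) auto
  finally show ?thesis by (simp add: random_dual_def)
qed

text \<open>The row set and the column set are chosen separately and each contributes its own
  summand, so the maximum of the sum is the sum of the two maxima.\<close>

lemma random_dual_top_sum:
  assumes k: "1 \<le> k1" "k1 \<le> m" "1 \<le> k2" "k2 \<le> n"
  shows "random_dual m n k1 k2 h g = 1 / sqrt (real k1 * real k2) *
    (top_sum m k1 h / sqrt k1 + top_sum n k2 g / sqrt k2)"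
proof -
  let ?A = "subsets_of_card m k1" and ?B = "subsets_of_card n k2"
  note ne = subsets_of_card_nonempty[OF k(2)] subsets_of_card_nonempty[OF k(4)]
  have "Max ((\<lambda>(I, J). (\<Sum>i=1..m. h i * (indicator I i / sqrt k1)) + (\<Sum>j=1..n. g j * (indicator J j / sqrt k2))) ` (?A \<times> ?B))
      = Max ((\<lambda>(I, J). (\<Sum>i\<in>I. h i) / sqrt k1 + (\<Sum>j\<in>J. g j) / sqrt k2) ` (?A \<times> ?B))"
    by (intro arg_cong[where f = Max] image_cong refl, elim SigmaE, simp only: split_conv sum_unit_indicator)
  also have "\<dots> = top_sum m k1 h / sqrt k1 + top_sum n k2 g / sqrt k2"
  proof (rule Max_eqI)
    have "top_sum m k1 h \<in> (\<lambda>I. \<Sum>i\<in>I. h i) ` ?A" "top_sum n k2 g \<in> (\<lambda>I. \<Sum>i\<in>I. g i) ` ?B"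
      unfolding top_sum_def using ne by (intro Max_in; simp)+
    then show "top_sum m k1 h / sqrt k1 + top_sum n k2 g / sqrt k2 \<in> (\<lambda>(I, J). (\<Sum>i\<in>I. h i) / sqrt k1 + (\<Sum>j\<in>J. g j) / sqrt k2) ` (?A \<times> ?B)"
      by force
  next
    fix y assume "y \<in> (\<lambda>(I, J). (\<Sum>i\<in>I. h i) / sqrt k1 + (\<Sum>j\<in>J. g j) / sqrt k2) ` (?A \<times> ?B)"
    then obtain I J where IJ: "I \<in> ?A" "J \<in> ?B" "y = (\<Sum>i\<in>I. h i) / sqrt k1 + (\<Sum>j\<in>J. g j) / sqrt k2"
      by auto
    have "(\<Sum>i\<in>I. h i) \<le> top_sum m k1 h" "(\<Sum>j\<in>J. g j) \<le> top_sum n k2 g"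
      unfolding top_sum_def using IJ by (auto intro!: Max_ge)
    then show "y \<le> top_sum m k1 h / sqrt k1 + top_sum n k2 g / sqrt k2"
      unfolding IJ(3) by (intro add_mono divide_right_mono) auto
  qed auto
  finally show ?thesis using random_dual_eq[of k1 k2] k by simp
qed

text \<open>The factor \<open>1 / (k1 * k2)\<close> is a product of two factors
  \<open>1 / sqrt (k1 * k2)\<close>. One stays outside, as in the random dual; the other normalises
  the outer products of indicators, so that the maximum runs over products of unit vectors.\<close>

lemma largest_avg_submatrix_eq:
  assumes k: "1 \<le> k1" "k1 \<le> m" "1 \<le> k2" "k2 \<le> n"
  shows "largest_avg_submatrix m n k1 k2 A = 1 / sqrt (real k1 * real k2) *
    Max ((\<lambda>(I, J). \<Sum>i=1..m. \<Sum>j=1..n. A i j * (indicator I i / sqrt k1 * (indicator J j / sqrt k2)))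
      ` (subsets_of_card m k1 \<times> subsets_of_card n k2))"
proof -
  let ?T = "subsets_of_card m k1 \<times> subsets_of_card n k2"
  define S where "S = (\<lambda>(I, J). \<Sum>i\<in>I. \<Sum>j\<in>J. A i j) ` ?T"
  have S: "finite S" "S \<noteq> {}"
    using subsets_of_card_nonempty[OF k(2)] subsets_of_card_nonempty[OF k(4)] by (auto simp: S_def)
  have "{\<Sum>i\<in>I1. \<Sum>j\<in>I2. A i j | I1 I2.
            I1 \<subseteq> {1..m} \<and> card I1 = k1 \<and> I2 \<subseteq> {1..n} \<and> card I2 = k2} = S"
    unfolding S_def by auto
  then have 1: "largest_avg_submatrix m n k1 k2 A = 1 / (real k1 * real k2) * Max S"
    by (simp add: largest_avg_submatrix_def)
  have img: "(\<lambda>(I, J). \<Sum>i=1..m. \<Sum>j=1..n. A i j * (indicator I i / sqrt k1 * (indicator J j / sqrt k2))) ` ?T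
      = (\<lambda>s. 1 / sqrt (real k1 * real k2) * s) ` S"
    unfolding S_def image_image
  proof (intro image_cong refl)
    fix p assume "p \<in> ?T"
    then obtain I J where p: "p = (I, J)" and I: "I \<in> subsets_of_card m k1" and J: "J \<in> subsets_of_card n k2" by auto
    have "(\<Sum>i=1..m. \<Sum>j=1..n. A i j * (indicator I i / sqrt k1 * (indicator J j / sqrt k2)))
        = (\<Sum>i=1..m. (\<Sum>j=1..n. A i j * (indicator J j / sqrt k2)) * (indicator I i / sqrt k1))"
      by (simp only: sum_distrib_left sum_distrib_right mult_ac)
    also have "\<dots> = 1 / sqrt (real k1 * real k2) * (\<Sum>i\<in>I. \<Sum>j\<in>J. A i j)"
      unfolding sum_unit_indicator[OF J] sum_unit_indicator[OF I]
      by (simp add: sum_divide_distrib real_sqrt_mult mult.commute)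
    finally show "(case p of (I, J) \<Rightarrow> \<Sum>i=1..m. \<Sum>j=1..n. A i j * (indicator I i / sqrt k1 * (indicator J j / sqrt k2)))
        = 1 / sqrt (real k1 * real k2) * (case p of (I, J) \<Rightarrow> \<Sum>i\<in>I. \<Sum>j\<in>J. A i j)"
      by (simp add: p)
  qed
  have mx: "1 / sqrt (real k1 * real k2) * Max S = Max ((\<lambda>s. 1 / sqrt (real k1 * real k2) * s) ` S)"
    by (rule mono_Max_commute[OF _ S]) (auto intro!: monoI divide_right_mono)
  have "1 / (real k1 * real k2) * Max S = 1 / sqrt (real k1 * real k2) * (1 / sqrt (real k1 * real k2) * Max S)"
    by simp
  then show ?thesis unfolding 1 img mx[symmetric] .
qed

lemma sum_outer_product_diff_le:
  fixes u u' :: "'i \<Rightarrow> real" and w w' :: "'j \<Rightarrow> real"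
  assumes "(\<Sum>i\<in>A. (u i)^2) = 1" "(\<Sum>i\<in>A. (u' i)^2) = 1" "(\<Sum>j\<in>B. (w j)^2) = 1" "(\<Sum>j\<in>B. (w' j)^2) = 1"
  shows "(\<Sum>i\<in>A. \<Sum>j\<in>B. (u i * w j - u' i * w' j)^2) \<le> (\<Sum>i\<in>A. (u i - u' i)^2) + (\<Sum>j\<in>B. (w j - w' j)^2)"
proof -
  define a where "a = (\<Sum>i\<in>A. u i * u' i)"
  define b where "b = (\<Sum>j\<in>B. w j * w' j)"
  have A: "(\<Sum>i\<in>A. (u i - u' i)^2) = 2 - 2 * a"
    using assms by (simp add: power2_diff sum.distrib sum_subtractf sum_distrib_left[symmetric] mult.assoc a_def)
  have B: "(\<Sum>j\<in>B. (w j - w' j)^2) = 2 - 2 * b"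
    using assms by (simp add: power2_diff sum.distrib sum_subtractf sum_distrib_left[symmetric] mult.assoc b_def)
  have "(\<Sum>i\<in>A. \<Sum>j\<in>B. (u i * w j - u' i * w' j)^2)
      = (\<Sum>i\<in>A. \<Sum>j\<in>B. (u i)^2 * (w j)^2) + (\<Sum>i\<in>A. \<Sum>j\<in>B. (u' i)^2 * (w' j)^2)
        - 2 * (\<Sum>i\<in>A. \<Sum>j\<in>B. (u i * u' i) * (w j * w' j))"
    by (simp add: power2_diff sum.distrib sum_subtractf sum_distrib_left power_mult_distrib mult_ac)
  also have "\<dots> = 2 - 2 * (a * b)"
    by (simp add: sum_product[symmetric] assms a_def b_def)
  finally have C: "(\<Sum>i\<in>A. \<Sum>j\<in>B. (u i * w j - u' i * w' j)^2) = 2 - 2 * (a * b)" .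
  \<comment> \<open>That the inner products \<open>a\<close> and \<open>b\<close> are at most 1 is
    read off from the sums of squares \<open>A\<close> and \<open>B\<close>. The two sides of the
    claim differ by \<open>2 * (1 - a) * (1 - b)\<close>.\<close>
  have "0 \<le> 2 - 2 * a" "0 \<le> 2 - 2 * b" unfolding A[symmetric] B[symmetric] by (auto intro: sum_nonneg)
  then have "0 \<le> (1 - a) * (1 - b)" by simp
  then show ?thesis unfolding A B C by (simp add: algebra_simps)
qed

lemma (in prob_space) expectation_largest_avg_submatrix_le_random_dual:
  fixes A :: "nat \<Rightarrow> nat \<Rightarrow> 'a \<Rightarrow> real" and h g :: "nat \<Rightarrow> 'a \<Rightarrow> real"
  assumes k: "1 \<le> k1" "k1 \<le> m" "1 \<le> k2" "k2 \<le> n"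
    and A: "\<And>i j. i \<in> {1..m} \<Longrightarrow> j \<in> {1..n} \<Longrightarrow> distributed M lborel (A i j) std_normal_density"
    and h: "\<And>i. i \<in> {1..m} \<Longrightarrow> distributed M lborel (h i) std_normal_density"
    and g: "\<And>j. j \<in> {1..n} \<Longrightarrow> distributed M lborel (g j) std_normal_density"
    and ind: "indep_vars (\<lambda>_. borel) (case_sum (\<lambda>(i, j). A i j) (case_sum h g))
            (({1..m} \<times> {1..n}) <+> ({1..m} <+> {1..n}))"
  shows "expectation (\<lambda>\<omega>. largest_avg_submatrix m n k1 k2 (\<lambda>i j. A i j \<omega>))
    \<le> expectation (\<lambda>\<omega>. random_dual m n k1 k2 (\<lambda>i. h i \<omega>) (\<lambda>j. g j \<omega>))"
proof -
  define D where "D = ({1..m} \<times> {1..n}) <+> ({1..m} <+> {1..n})"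
  define T where "T = subsets_of_card m k1 \<times> subsets_of_card n k2"
  define V where "V = case_sum (\<lambda>(i, j). A i j) (case_sum h g)"
  define u where "u I i = indicator I i / sqrt k1" for I and i :: nat
  define w where "w J j = indicator J j / sqrt k2" for J and j :: nat
  \<comment> \<open>The index type has three blocks: matrix entries, entries of \<open>h\<close> and
    entries of \<open>g\<close>. The coefficients are the outer product on the first block and the
    unit vectors on the other two. The scales \<open>s\<close> keep only the matrix block, giving
    the bilinear form; \<open>t\<close> keeps only the vector blocks, giving the dual.\<close>
  define e where "e d p = (case p of (I, J) \<Rightarrow> case_sum (\<lambda>(i, j). u I i * w J j) (case_sum (u I) (w J)) d)"
    for d :: "nat \<times> nat + nat + nat" and p
  define s :: "nat \<times> nat + nat + nat \<Rightarrow> real" where "s = case_sum (\<lambda>_. 1) (\<lambda>_. 0)"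
  define t :: "nat \<times> nat + nat + nat \<Rightarrow> real" where "t = case_sum (\<lambda>_. 0) (\<lambda>_. 1)"
  have sumD: "(\<Sum>d\<in>D. f d) = (\<Sum>i=1..m. \<Sum>j=1..n. f (Inl (i, j))) + ((\<Sum>i=1..m. f (Inr (Inl i))) + (\<Sum>j=1..n. f (Inr (Inr j))))"
    for f :: "nat \<times> nat + nat + nat \<Rightarrow> real"
    by (simp add: D_def sum.Plus sum.cartesian_product)
  have le: "expectation (\<lambda>\<omega>. Max ((\<lambda>p. \<Sum>d\<in>D. s d * V d \<omega> * e d p) ` T))
      \<le> expectation (\<lambda>\<omega>. Max ((\<lambda>p. \<Sum>d\<in>D. t d * V d \<omega> * e d p) ` T))"
  proof (rule sudakov_fernique)
    show "finite D" by (simp add: D_def)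
    show "finite T" by (simp add: T_def)
    show "T \<noteq> {}" using subsets_of_card_nonempty[OF k(2)] subsets_of_card_nonempty[OF k(4)] by (auto simp: T_def)
    show "indep_vars (\<lambda>_. borel) V D" using ind by (simp add: V_def D_def)
    show "distributed M lborel (V d) std_normal_density" if "d \<in> D" for d
      using that by (auto simp: V_def D_def A h g)
    show "0 \<le> s d" "0 \<le> t d" for d by (auto simp: s_def t_def split: sum.split)
    fix p q assume "p \<in> T" "q \<in> T"
    then obtain I J I' J' where pq: "p = (I, J)" "q = (I', J')"
      and I: "I \<in> subsets_of_card m k1" "I' \<in> subsets_of_card m k1"
      and J: "J \<in> subsets_of_card n k2" "J' \<in> subsets_of_card n k2" by (auto simp: T_def)
    show "(\<Sum>d\<in>D. (s d * (e d p - e d q))^2) \<le> (\<Sum>d\<in>D. (t d * (e d p - e d q))^2)"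
      unfolding sumD using sum_outer_product_diff_le[of "u I" "{1..m}" "u I'" "w J" "{1..n}" "w J'"]
      unit_indicator_norm[OF I(1) k(1)] unit_indicator_norm[OF I(2) k(1)]
      unit_indicator_norm[OF J(1) k(3)] unit_indicator_norm[OF J(2) k(3)]
      by (simp add: e_def s_def t_def pq u_def w_def)
  qed
  have xi: "largest_avg_submatrix m n k1 k2 (\<lambda>i j. A i j \<omega>)
      = 1 / sqrt (real k1 * real k2) * Max ((\<lambda>p. \<Sum>d\<in>D. s d * V d \<omega> * e d p) ` T)" for \<omega>
    unfolding largest_avg_submatrix_eq[OF k] sumD T_def
    by (intro arg_cong[where f = "\<lambda>S. _ * Max S"] image_cong) (auto simp: s_def V_def e_def u_def w_def)
  have L: "random_dual m n k1 k2 (\<lambda>i. h i \<omega>) (\<lambda>j. g j \<omega>)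
      = 1 / sqrt (real k1 * real k2) * Max ((\<lambda>p. \<Sum>d\<in>D. t d * V d \<omega> * e d p) ` T)" for \<omega>
    unfolding random_dual_eq[OF k(1,3)] sumD T_def
    by (intro arg_cong[where f = "\<lambda>S. _ * Max S"] image_cong) (auto simp: t_def V_def e_def u_def w_def)
  show ?thesis unfolding xi L integral_mult_right_zero by (intro mult_left_mono le) simp
qed

section \<open>Sums of the largest entries\<close>

text \<open>Cauchy--Schwarz on \<open>Y - X\<close> against the constant 1; the squares are then
  summed over all of \<open>A\<close>, so the bound depends on \<open>X\<close> and \<open>Y\<close>
  only through their sizes.\<close>

lemma abs_sum_diff_le_sqrt:
  fixes h :: "'i \<Rightarrow> real"
  assumes "finite A" "X \<subseteq> Y" "Y \<subseteq> A"
  shows "\<bar>sum h Y - sum h X\<bar> \<le> sqrt ((real (card Y) - real (card X)) * (\<Sum>i\<in>A. (h i)^2))"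
proof -
  have fY: "finite Y" using assms finite_subset by blast
  have "\<bar>sum h Y - sum h X\<bar> = sqrt ((\<Sum>i\<in>Y - X. 1 * h i)^2)"
    using assms fY by (simp add: sum_diff)
  also have "\<dots> \<le> sqrt ((\<Sum>i\<in>Y - X. 1^2) * (\<Sum>i\<in>Y - X. (h i)^2))"
    by (intro real_sqrt_le_mono Cauchy_Schwarz_ineq_sum)
  also have "\<dots> \<le> sqrt ((real (card Y) - real (card X)) * (\<Sum>i\<in>A. (h i)^2))"
    using assms fY card_mono[OF fY assms(2)]
    by (intro real_sqrt_le_mono mult_mono sum_mono2)
       (auto simp: card_Diff_subset finite_subset[OF assms(2)] of_nat_diff intro: sum_nonneg)
  finally show ?thesis .
qed

text \<open>Enlarge or shrink \<open>W\<close> to size \<open>k\<close>. This is how the random set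
  of exceedances is compared with a competitor of exactly \<open>k\<close> elements.\<close>

lemma exists_nested_subset_of_card:
  assumes "finite A" "W \<subseteq> A" "k \<le> card A"
  obtains I where "I \<subseteq> A" "card I = k" "I \<subseteq> W \<or> W \<subseteq> I"
proof (cases "card W \<le> k")
  case True
  from exists_subset_between[OF True assms(3,2,1)] that show ?thesis by blast
next
  case False
  then obtain I where "I \<subseteq> W" "card I = k" using obtain_subset_with_card_n[of k W] by auto
  with that assms show ?thesis by blast
qed

text \<open>\<open>UNIV\<close> stands for the threshold \<open>-\<infinity>\<close>, needed when \<open>k / d\<close> tends to 1; then \<open>t\<close> is arbitrary.\<close>

definition threshold_set :: "real \<Rightarrow> real set \<Rightarrow> bool" where
  "threshold_set t U \<longleftrightarrow> U = UNIV \<or> U = {t<..}"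

lemma borel_threshold_set: "threshold_set t U \<Longrightarrow> U \<in> sets borel"
  by (auto simp: threshold_set_def)

text \<open>Let \<open>W\<close> be the set of indices with \<open>h i\<close> in \<open>U\<close>,
  so that \<open>c\<close> is the distance of \<open>card W\<close> from \<open>k\<close>. For the
  lower bound, a \<open>k\<close>-set nested with \<open>W\<close> is a competitor and differs from
  \<open>W\<close> by \<open>c\<close> entries. For the upper bound, \<open>W\<close> maximises the
  sum of \<open>h i - t\<close>, so an optimal \<open>k\<close>-set gains at most \<open>t\<close>
  times the difference in size; when \<open>U = UNIV\<close>, every \<open>k\<close>-set is nested
  in \<open>W\<close>.\<close>

lemma abs_top_sum_diff_le:
  fixes h :: "nat \<Rightarrow> real"
  assumes k: "k \<le> d" and U: "threshold_set t U"
  defines "c \<equiv> \<bar>(\<Sum>i=1..d. indicator U (h i)) - real k\<bar>"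
  shows "\<bar>top_sum d k h - (\<Sum>i=1..d. h i * indicator U (h i))\<bar>
    \<le> \<bar>t\<bar> * c + sqrt (c * (\<Sum>i=1..d. (h i)^2))"
proof -
  define W where "W = {i\<in>{1..d}. h i \<in> U}"
  have W: "W \<subseteq> {1..d}" "finite W" by (auto simp: W_def)
  have sW: "(\<Sum>i=1..d. f i * indicator U (h i)) = sum f W" for f :: "nat \<Rightarrow> real"
  proof -
    have "(\<Sum>i=1..d. f i * indicator U (h i)) = (\<Sum>i=1..d. if h i \<in> U then f i else 0)"
      by (intro sum.cong) auto
    then show ?thesis by (simp only: W_def sum.inter_filter finite_atLeastAtMost)
  qed
  have cW: "(\<Sum>i=1..d. indicator U (h i)) = real (card W)"
    using sW[of "\<lambda>_. 1"] by simp
  have cc: "c = \<bar>real (card W) - real k\<bar>" unfolding c_def cW ..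
  have c0: "0 \<le> c" "0 \<le> \<bar>t\<bar> * c" by (simp_all add: c_def)
  define Q where "Q = (\<Sum>i=1..d. (h i)^2)"
  have Q0: "0 \<le> Q" unfolding Q_def by (intro sum_nonneg) simp
  have nested: "\<bar>sum h I - sum h W\<bar> \<le> sqrt (c * Q)" if "I \<subseteq> {1..d}" "card I = k" "I \<subseteq> W \<or> W \<subseteq> I" for I
    using that(3)
  proof
    assume "I \<subseteq> W"
    from abs_sum_diff_le_sqrt[OF _ this W(1), of h] card_mono[OF W(2) this] that show ?thesis
      by (simp add: cc Q_def abs_minus_commute)
  next
    assume "W \<subseteq> I"
    from abs_sum_diff_le_sqrt[OF _ this that(1), of h] card_mono[OF _ this] that show ?thesis
      by (simp add: cc Q_def finite_subset[OF that(1)])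
  qed
  have lower: "sum h W - sqrt (c * Q) \<le> top_sum d k h"
  proof -
    obtain I where I: "I \<subseteq> {1..d}" "card I = k" "I \<subseteq> W \<or> W \<subseteq> I"
      by (rule exists_nested_subset_of_card[of "{1..d}" W k]) (use k W in auto)
    have "sum h I \<le> top_sum d k h"
      unfolding top_sum_def using I by (intro Max_ge) auto
    with nested[OF I] show ?thesis by linarith
  qed
  have "top_sum d k h \<in> (\<lambda>I. \<Sum>i\<in>I. h i) ` subsets_of_card d k"
    unfolding top_sum_def using subsets_of_card_nonempty[OF k] by (intro Max_in) simp_all
  then obtain I where I: "I \<subseteq> {1..d}" "card I = k" "top_sum d k h = sum h I" by auto
  have "top_sum d k h \<le> sum h W + (\<bar>t\<bar> * c + sqrt (c * Q))"
  proof (cases "U = UNIV")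
    case True
    then have "I \<subseteq> W" using I by (auto simp: W_def)
    from nested[OF I(1,2) disjI1[OF this]] I(3) c0(2) show ?thesis by linarith
  next
    case False
    with U have U': "U = {t<..}" by (simp add: threshold_set_def)
    \<comment> \<open>The positive part of \<open>h i - t\<close> dominates on \<open>I\<close>, and
      summed over all indices it sees exactly the exceedances.\<close>
    have "(\<Sum>i\<in>I. h i - t) \<le> (\<Sum>i\<in>I. max (h i - t) 0)" by (intro sum_mono) auto
    also have "\<dots> \<le> (\<Sum>i=1..d. max (h i - t) 0)" using I by (intro sum_mono2) auto
    also have "\<dots> = (\<Sum>i\<in>W. h i - t)"
      unfolding sW[symmetric] by (intro sum.cong) (auto simp: U' max_def)
    finally have "sum h I \<le> sum h W + t * (real k - real (card W))"
      using I by (simp add: sum_subtractf algebra_simps)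
    also have "t * (real k - real (card W)) \<le> \<bar>t\<bar> * c"
      unfolding cc by (metis abs_ge_self abs_minus_commute abs_mult)
    also have "\<bar>t\<bar> * c \<le> \<bar>t\<bar> * c + sqrt (c * Q)" using c0 Q0 by simp
    finally show ?thesis using I by simp
  qed
  with lower c0 show ?thesis unfolding sW Q_def abs_le_iff by linarith
qed

text \<open>Replaces the root of a product of two dependent variables by a linear expression, whose
  expectation needs only the two means. The weight is left free to be optimised later.\<close>

lemma sqrt_mult_le_AM:
  fixes c q \<delta> :: real
  assumes "0 \<le> c" "0 \<le> q" "0 < \<delta>"
  shows "sqrt (c * q) \<le> c / (2 * \<delta>) + \<delta> * q / 2"
proof -
  have "sqrt (c * q) = sqrt ((c / \<delta>) * (\<delta> * q))" using assms by simp
  also have "\<dots> \<le> (c / \<delta> + \<delta> * q) / 2" using assms by (intro arith_geo_mean_sqrt) auto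
  finally show ?thesis using assms by (simp add: field_simps)
qed

lemma (in prob_space) expectation_sum_power2_indep:
  fixes Y :: "'i \<Rightarrow> 'a \<Rightarrow> real"
  assumes I: "finite I" and ind: "indep_vars (\<lambda>_. borel) Y I"
    and Y: "\<And>i. i \<in> I \<Longrightarrow> integrable M (Y i)" and Y0: "\<And>i. i \<in> I \<Longrightarrow> expectation (Y i) = 0"
    and Y2: "\<And>i. i \<in> I \<Longrightarrow> integrable M (\<lambda>\<omega>. (Y i \<omega>)^2)"
  shows "integrable M (\<lambda>\<omega>. (\<Sum>i\<in>I. Y i \<omega>)^2)"
    and "expectation (\<lambda>\<omega>. (\<Sum>i\<in>I. Y i \<omega>)^2) = (\<Sum>i\<in>I. expectation (\<lambda>\<omega>. (Y i \<omega>)^2))"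
proof -
  have eq: "(\<Sum>i\<in>I. Y i \<omega>)^2 = (\<Sum>i\<in>I. \<Sum>j\<in>I. Y i \<omega> * Y j \<omega>)" for \<omega>
    by (simp add: power2_eq_square sum_product)
  have ij: "integrable M (\<lambda>\<omega>. Y i \<omega> * Y j \<omega>) \<and>
      expectation (\<lambda>\<omega>. Y i \<omega> * Y j \<omega>) = (if i = j then expectation (\<lambda>\<omega>. (Y i \<omega>)^2) else 0)"
    if "i \<in> I" "j \<in> I" for i j
  proof (cases "i = j")
    case False
    have *: "indep_vars (\<lambda>_. borel) Y {i, j}" using ind that by (rule_tac indep_vars_subset) auto
    have Yij: "integrable M (Y l)" if "l \<in> {i, j}" for l using that \<open>i \<in> I\<close> \<open>j \<in> I\<close> Y by auto
    from indep_vars_integrable[OF _ * Yij] indep_vars_lebesgue_integral[OF _ * Yij] False that show ?thesis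
      by (auto simp: Y Y0)
  qed (use that Y2 in \<open>simp add: power2_eq_square\<close>)
  show "integrable M (\<lambda>\<omega>. (\<Sum>i\<in>I. Y i \<omega>)^2)"
    unfolding eq using ij by (intro Bochner_Integration.integrable_sum) auto
  show "expectation (\<lambda>\<omega>. (\<Sum>i\<in>I. Y i \<omega>)^2) = (\<Sum>i\<in>I. expectation (\<lambda>\<omega>. (Y i \<omega>)^2))"
    unfolding eq using ij I by (simp add: Bochner_Integration.integral_sum Bochner_Integration.integrable_sum)
qed

text \<open>The number of entries in \<open>U\<close> has mean \<open>d * p\<close> and variance at
  most \<open>d\<close>, so its mean distance from \<open>k\<close> is at most \<open>sqrt d\<close>
  plus the bias. Inserting this and the mean \<open>d\<close> of the sum of squares into the
  pointwise bound, linearised with weight \<open>\<delta>\<close>, gives the claim.\<close>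

lemma (in prob_space) expectation_top_sum_bound:
  fixes h :: "nat \<Rightarrow> 'a \<Rightarrow> real"
  assumes k: "k \<le> d" and d: "1 \<le> d"
    and h: "\<And>i. i \<in> {1..d} \<Longrightarrow> distributed M lborel (h i) std_normal_density"
    and ind: "indep_vars (\<lambda>_. borel) h {1..d}"
    and U: "threshold_set t U" and \<delta>: "0 < \<delta>"
  defines "p \<equiv> measure std_normal_distribution U"
    and "\<mu> \<equiv> (\<integral>x. x * indicator U x \<partial>std_normal_distribution)"
  shows "integrable M (\<lambda>\<omega>. top_sum d k (\<lambda>i. h i \<omega>))"
    and "\<bar>expectation (\<lambda>\<omega>. top_sum d k (\<lambda>i. h i \<omega>)) - real d * \<mu>\<bar>
      \<le> (\<bar>t\<bar> + 1 / (2 * \<delta>)) * (sqrt (real d) + \<bar>real d * p - real k\<bar>) + \<delta> * real d / 2"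
proof -
  let ?N = std_normal_distribution
  interpret N: real_distribution ?N by (rule real_dist_normal_dist)
  note UB[measurable] = borel_threshold_set[OF U]
  have rv: "random_variable borel (h i)" if "i \<in> {1..d}" for i
    using h[OF that] by (auto dest: distributed_measurable)
  have comp: "expectation (\<lambda>\<omega>. f (h i \<omega>)) = (\<integral>x. f x \<partial>?N)"
      "integrable ?N f \<Longrightarrow> integrable M (\<lambda>\<omega>. f (h i \<omega>))"
    if "i \<in> {1..d}" "f \<in> borel_measurable borel" for i and f :: "real \<Rightarrow> real"
    using integral_distr[OF rv[OF that(1)], of f] integrable_distr_eq[OF rv[OF that(1)], of f] that
    by (simp_all add: distributed_std_normal_distr[OF h[OF that(1)]])
  have N1: "integrable ?N (\<lambda>x. x)" using integrable_std_normal_distribution_moment[of 1] by simp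
  have N2: "integrable ?N (\<lambda>x. x^2)" "(\<integral>x. x^2 \<partial>?N) = 1"
    using std_normal_distribution_even_moments[of 1] by simp_all
  have NU: "integrable ?N (\<lambda>x. x * indicator U x)"
    by (rule Bochner_Integration.integrable_bound[OF N1]) (auto simp: indicator_def)
  have NI: "integrable ?N (indicator U :: real \<Rightarrow> real)" "(\<integral>x. indicator U x \<partial>?N) = p"
    by (auto simp: p_def intro!: N.integrable_const_bound[where B = 1])
  have Np: "(\<integral>x. (indicator U x - p)^2 \<partial>?N) \<le> 1" "integrable ?N (\<lambda>x. (indicator U x - p)^2)"
  proof -
    have p01: "0 \<le> p" "p \<le> 1" by (simp_all add: p_def)
    have b: "(indicator U x - p)^2 \<le> 1" for x
    proof -
      have "\<bar>indicator U x - p\<bar> \<le> 1" using p01 by (cases "x \<in> U") auto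
      then show ?thesis by (simp add: abs_square_le_1)
    qed
    show i: "integrable ?N (\<lambda>x. (indicator U x - p)^2)"
      by (rule N.integrable_const_bound[where B = 1]) (use b in auto)
    have "(\<integral>x. (indicator U x - p)^2 \<partial>?N) \<le> (\<integral>x. 1 \<partial>?N)"
      by (intro integral_mono i b) auto
    then show "(\<integral>x. (indicator U x - p)^2 \<partial>?N) \<le> 1" using N.prob_space by simp
  qed
  have ih: "integrable M (h i)" if "i \<in> {1..d}" for i
    using comp(2)[OF that _ N1] by simp
  show top: "integrable M (\<lambda>\<omega>. top_sum d k (\<lambda>i. h i \<omega>))"
    unfolding top_sum_def
    using subsets_of_card_nonempty[OF k] by (intro integrable_Max Bochner_Integration.integrable_sum ih) auto

  define S where "S \<omega> = (\<Sum>i=1..d. h i \<omega> * indicator U (h i \<omega>))" for \<omega>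
  define Q where "Q \<omega> = (\<Sum>i=1..d. (h i \<omega>)^2)" for \<omega>
  define Y where "Y i \<omega> = indicator U (h i \<omega>) - p" for i \<omega>
  define Z where "Z \<omega> = (\<Sum>i=1..d. Y i \<omega>)" for \<omega>
  have sumI: "integrable M (\<lambda>\<omega>. \<Sum>i=1..d. f i \<omega>)" "expectation (\<lambda>\<omega>. \<Sum>i=1..d. f i \<omega>) = real d * c"
    if "\<And>i. i \<in> {1..d} \<Longrightarrow> integrable M (f i)" "\<And>i. i \<in> {1..d} \<Longrightarrow> expectation (f i) = c"
    for f :: "nat \<Rightarrow> 'a \<Rightarrow> real" and c
    using that by (auto simp: Bochner_Integration.integral_sum intro!: Bochner_Integration.integrable_sum)
  have S: "integrable M S" "expectation S = real d * \<mu>"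
  proof -
    have f: "integrable M (\<lambda>\<omega>. h i \<omega> * indicator U (h i \<omega>))"
        "expectation (\<lambda>\<omega>. h i \<omega> * indicator U (h i \<omega>)) = \<mu>" if "i \<in> {1..d}" for i
      using comp(1)[OF that, of "\<lambda>x. x * indicator U x"] comp(2)[OF that _ NU] by (simp_all add: \<mu>_def)
    show "integrable M S" "expectation S = real d * \<mu>"
      unfolding S_def[abs_def] by (rule sumI, erule f(1), erule f(2))+
  qed
  have Q: "integrable M Q" "expectation Q = real d"
  proof -
    have f: "integrable M (\<lambda>\<omega>. (h i \<omega>)^2)" "expectation (\<lambda>\<omega>. (h i \<omega>)^2) = 1" if "i \<in> {1..d}" for i
      using comp(1)[OF that, of "\<lambda>x. x^2"] comp(2)[OF that _ N2(1)] N2(2) by simp_all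
    have "integrable M Q" "expectation Q = real d * 1"
      unfolding Q_def[abs_def] by (rule sumI, erule f(1), erule f(2))+
    then show "integrable M Q" "expectation Q = real d" by simp_all
  qed
  have YI: "indep_vars (\<lambda>_. borel) Y {1..d}"
    unfolding Y_def using indep_vars_compose2[OF ind, of "\<lambda>_ x. indicator U x - p" "\<lambda>_. borel"] by simp
  have Y1: "integrable M (Y i)" "expectation (Y i) = 0" if "i \<in> {1..d}" for i
  proof -
    have "integrable ?N (\<lambda>x. indicator U x - p)" "(\<integral>x. indicator U x - p \<partial>?N) = 0"
      using NI N.prob_space by simp_all
    then show "integrable M (Y i)" "expectation (Y i) = 0"
      using comp[OF that, of "\<lambda>x. indicator U x - p"] unfolding Y_def[abs_def] by simp_all
  qed
  have Y2: "integrable M (\<lambda>\<omega>. (Y i \<omega>)^2)" "expectation (\<lambda>\<omega>. (Y i \<omega>)^2) \<le> 1" if "i \<in> {1..d}" for i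
    using comp[OF that, of "\<lambda>x. (indicator U x - p)^2"] Np unfolding Y_def[abs_def] by simp_all
  have Z: "integrable M (\<lambda>\<omega>. (Z \<omega>)^2)" "expectation (\<lambda>\<omega>. (Z \<omega>)^2) \<le> real d"
    unfolding Z_def using expectation_sum_power2_indep[OF _ YI Y1 Y2(1)] sum_mono[of "{1..d}", OF Y2(2)]
    by simp_all
  have Z1: "integrable M Z" unfolding Z_def using Y1 by auto
  \<comment> \<open>The first moment is obtained from the second by the arithmetic-geometric
    inequality with weight \<open>sqrt d\<close>, which balances its two terms.\<close>
  have Zb: "expectation (\<lambda>\<omega>. \<bar>Z \<omega>\<bar>) \<le> sqrt (real d)"
  proof -
    have "expectation (\<lambda>\<omega>. \<bar>Z \<omega>\<bar>) \<le> expectation (\<lambda>\<omega>. (Z \<omega>)^2 / (2 * sqrt (real d)) + sqrt (real d) / 2)"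
    proof (intro integral_mono)
      fix \<omega>
      have "\<bar>Z \<omega>\<bar> = sqrt ((Z \<omega>)^2 * 1)" by simp
      also have "\<dots> \<le> (Z \<omega>)^2 / (2 * sqrt (real d)) + sqrt (real d) * 1 / 2"
        using d by (intro sqrt_mult_le_AM) auto
      finally show "\<bar>Z \<omega>\<bar> \<le> (Z \<omega>)^2 / (2 * sqrt (real d)) + sqrt (real d) / 2" by simp
    qed (use Z1 Z in auto)
    also have "\<dots> = expectation (\<lambda>\<omega>. (Z \<omega>)^2) / (2 * sqrt (real d)) + sqrt (real d) / 2"
      using Z by (simp add: prob_space)
    also have "\<dots> \<le> real d / (2 * sqrt (real d)) + sqrt (real d) / 2"
      using Z by (intro add_right_mono divide_right_mono) auto
    also have "\<dots> = sqrt (real d)" using d by (simp add: field_simps)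
    finally show ?thesis .
  qed
  \<comment> \<open>A pointwise majorant of the error that is linear in
    \<open>\<bar>Z \<omega>\<bar>\<close> and \<open>Q \<omega>\<close>; the count of entries in
    \<open>U\<close> is \<open>Z + d * p\<close>.\<close>
  define B where "B \<omega> = (\<bar>t\<bar> + 1 / (2 * \<delta>)) * (\<bar>Z \<omega>\<bar> + \<bar>real d * p - real k\<bar>) + \<delta> / 2 * Q \<omega>" for \<omega>
  have IB: "integrable M B" unfolding B_def using Z1 Q by auto
  have "\<bar>top_sum d k (\<lambda>i. h i \<omega>) - S \<omega>\<bar> \<le> B \<omega>" for \<omega>
  proof -
    define c where "c = \<bar>(\<Sum>i=1..d. indicator U (h i \<omega>)) - real k\<bar>"
    have Q0: "0 \<le> Q \<omega>" unfolding Q_def by (intro sum_nonneg) simp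
    have "(\<Sum>i=1..d. indicator U (h i \<omega>)) = Z \<omega> + real d * p"
      unfolding Z_def Y_def sum_subtractf by simp
    then have cb: "c \<le> \<bar>Z \<omega>\<bar> + \<bar>real d * p - real k\<bar>" unfolding c_def by linarith
    have "\<bar>top_sum d k (\<lambda>i. h i \<omega>) - S \<omega>\<bar> \<le> \<bar>t\<bar> * c + sqrt (c * Q \<omega>)"
      using abs_top_sum_diff_le[OF k U, of "\<lambda>i. h i \<omega>"] by (simp add: S_def Q_def c_def)
    also have "\<dots> \<le> \<bar>t\<bar> * c + (c / (2 * \<delta>) + \<delta> * Q \<omega> / 2)"
      using \<delta> Q0 by (intro add_left_mono sqrt_mult_le_AM) (auto simp: c_def)
    also have "\<dots> = (\<bar>t\<bar> + 1 / (2 * \<delta>)) * c + \<delta> / 2 * Q \<omega>" by (simp add: algebra_simps)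
    also have "\<dots> \<le> B \<omega>" unfolding B_def using \<delta> by (intro add_right_mono mult_left_mono cb) auto
    finally show ?thesis .
  qed
  then have "expectation (\<lambda>\<omega>. \<bar>top_sum d k (\<lambda>i. h i \<omega>) - S \<omega>\<bar>) \<le> expectation B"
    using top S IB by (intro integral_mono) auto
  moreover have "\<bar>expectation (\<lambda>\<omega>. top_sum d k (\<lambda>i. h i \<omega>) - S \<omega>)\<bar> \<le> expectation (\<lambda>\<omega>. \<bar>top_sum d k (\<lambda>i. h i \<omega>) - S \<omega>\<bar>)"
    by (rule integral_abs_bound)
  moreover have "expectation (\<lambda>\<omega>. top_sum d k (\<lambda>i. h i \<omega>) - S \<omega>) = expectation (\<lambda>\<omega>. top_sum d k (\<lambda>i. h i \<omega>)) - real d * \<mu>"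
    using top S by simp
  moreover have "expectation B = (\<bar>t\<bar> + 1 / (2 * \<delta>)) * (expectation (\<lambda>\<omega>. \<bar>Z \<omega>\<bar>) + \<bar>real d * p - real k\<bar>) + \<delta> / 2 * real d"
    unfolding B_def using Z1 Q by (simp add: prob_space)
  moreover have "\<dots> \<le> (\<bar>t\<bar> + 1 / (2 * \<delta>)) * (sqrt (real d) + \<bar>real d * p - real k\<bar>) + \<delta> / 2 * real d"
    using \<delta> Zb by (intro add_right_mono mult_left_mono) auto
  ultimately show "\<bar>expectation (\<lambda>\<omega>. top_sum d k (\<lambda>i. h i \<omega>)) - real d * \<mu>\<bar>
      \<le> (\<bar>t\<bar> + 1 / (2 * \<delta>)) * (sqrt (real d) + \<bar>real d * p - real k\<bar>) + \<delta> * real d / 2"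
    by simp
qed

section \<open>Limits in the proportional regime\<close>

lemma (in prob_space) indep_vars_reindex:
  assumes f: "inj_on f I" and X: "indep_vars M' X (f ` I)"
  shows "indep_vars (\<lambda>i. M' (f i)) (\<lambda>i. X (f i)) I"
  unfolding indep_vars_def2 indep_sets_def
proof (intro conjI ballI allI impI)
  from X have rv: "\<And>i. i \<in> f ` I \<Longrightarrow> X i \<in> measurable M (M' i)"
    and ind: "indep_sets (\<lambda>i. {X i -` A \<inter> space M | A. A \<in> sets (M' i)}) (f ` I)"
    by (auto simp: indep_vars_def2)
  show "X (f i) \<in> measurable M (M' (f i))" if "i \<in> I" for i using rv that by auto
  show "{X (f i) -` A \<inter> space M | A. A \<in> sets (M' (f i))} \<subseteq> events" if "i \<in> I" for i
    using rv[of "f i"] that by (auto intro: measurable_sets)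
  fix J A assume J: "J \<subseteq> I" "J \<noteq> {}" "finite J" and A: "A \<in> (\<Pi> i\<in>J. {X (f i) -` A \<inter> space M | A. A \<in> sets (M' (f i))})"
  define B where "B = A \<circ> inv_into J f"
  have fJ: "inj_on f J" using f J(1) by (rule inj_on_subset)
  have B: "B (f j) = A j" if "j \<in> J" for j using that fJ by (simp add: B_def)
  have "prob (\<Inter>i\<in>f ` J. B i) = (\<Prod>i\<in>f ` J. prob (B i))"
  proof (rule indep_setsD[OF ind])
    show "\<forall>i\<in>f ` J. B i \<in> {X i -` A \<inter> space M | A. A \<in> sets (M' i)}"
      using A B by (auto simp del: mem_Collect_eq)
  qed (use J in auto)
  then show "prob (\<Inter> (A ` J)) = (\<Prod>i\<in>J. prob (A i))"
    using B by (simp add: prod.reindex[OF fJ])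
qed

text \<open>The normal law has no atoms, so its distribution function is continuous and the
  intermediate value theorem yields \<open>t\<close> with tail mass \<open>p\<close>. No finite
  threshold has tail mass 1; there \<open>UNIV\<close> is taken with the dummy value
  \<open>t = 0\<close>.\<close>

lemma exists_threshold_set:
  assumes p: "0 < p" "p \<le> 1"
  obtains t U where "threshold_set t U" "measure std_normal_distribution U = p"
proof (cases "p = 1")
  case True
  interpret N: real_distribution std_normal_distribution by (rule real_dist_normal_dist)
  show ?thesis by (rule that[of 0 UNIV]) (use True N.prob_space in \<open>auto simp: threshold_set_def\<close>)
next
  case False
  let ?N = std_normal_distribution
  interpret N: real_distribution ?N by (rule real_dist_normal_dist)
  have "measure ?N {x} = 0" for x
  proof -
    have "emeasure ?N {x} = (\<integral>\<^sup>+y. std_normal_density y * indicator {x} y \<partial>lborel)"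
      by (subst emeasure_density) auto
    also have "\<dots> = 0"
      by (subst nn_integral_0_iff_AE) (use AE_lborel_singleton[of x] in \<open>auto elim!: eventually_mono\<close>)
    finally show ?thesis by (simp add: measure_def)
  qed
  then have cont: "isCont (cdf ?N) x" for x by (simp add: N.isCont_cdf)
  have "\<forall>\<^sub>F x in at_bot. cdf ?N x < 1 - p"
    using p False by (intro order_tendstoD(2)[OF N.cdf_lim_at_bot]) auto
  then obtain a where a: "\<And>x. x \<le> a \<Longrightarrow> cdf ?N x < 1 - p" by (auto simp: eventually_at_bot_linorder)
  have "\<forall>\<^sub>F x in at_top. 1 - p < cdf ?N x"
    using p by (intro order_tendstoD(1)[OF N.cdf_lim_at_top_prob]) auto
  then obtain b where b: "\<And>x. b \<le> x \<Longrightarrow> 1 - p < cdf ?N x" by (auto simp: eventually_at_top_linorder)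
  \<comment> \<open>The two limits give \<open>a\<close> and \<open>b\<close> in no particular
    order, hence \<open>max a b\<close> as the right end.\<close>
  have "\<exists>t\<ge>a. t \<le> max a b \<and> cdf ?N t = 1 - p"
    by (rule IVT) (use a[of a] b[of "max a b"] cont in auto)
  then obtain t where t: "cdf ?N t = 1 - p" by auto
  have "measure ?N {t<..} = 1 - measure ?N {..t}"
    using N.prob_compl[of "{..t}"] by (simp add: Compl_eq_Diff_UNIV[symmetric])
  with t show ?thesis by (intro that[of t "{t<..}"]) (auto simp: threshold_set_def cdf_def)
qed

text \<open>Since \<open>k / n\<close> tends to \<open>\<alpha> * p\<close>, the normalised counting
  error tends to 0. The assumed bound holds for every weight, so a weight depending on
  \<open>n\<close> may tend to 0 slowly enough that the error divided by it still vanishes.\<close>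

lemma top_sum_scaling_limit:
  fixes d k :: "nat \<Rightarrow> nat" and E :: "nat \<Rightarrow> real"
  assumes d: "(\<lambda>n. real (d n) / real n) \<longlonglongrightarrow> \<alpha>" and k: "(\<lambda>n. real (k n) / real n) \<longlonglongrightarrow> \<alpha> * p"
    and E: "\<And>n \<delta>. 1 \<le> n \<Longrightarrow> 0 < \<delta> \<Longrightarrow> \<bar>E n - real (d n) * \<mu>\<bar>
      \<le> (\<bar>t\<bar> + 1 / (2 * \<delta>)) * (sqrt (real (d n)) + \<bar>real (d n) * p - real (k n)\<bar>) + \<delta> * real (d n) / 2"
  shows "(\<lambda>n. E n / real n) \<longlonglongrightarrow> \<alpha> * \<mu>"
proof -
  define \<epsilon> where "\<epsilon> n = (sqrt (real (d n)) + \<bar>real (d n) * p - real (k n)\<bar>) / real n" for n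
  \<comment> \<open>\<open>sqrt (\<epsilon> n)\<close> balances \<open>\<epsilon> / \<delta>\<close> against \<open>\<delta>\<close>; the summand \<open>1 / n\<close> keeps \<open>\<delta>\<close> positive\<close>
  define \<delta> where "\<delta> n = sqrt (\<epsilon> n) + 1 / real n" for n
  have \<epsilon>0: "0 \<le> \<epsilon> n" for n by (simp add: \<epsilon>_def)
  \<comment> \<open>Writing \<open>sqrt d / n\<close> as \<open>sqrt (d / n) * sqrt (1 / n)\<close>
    shows that the fluctuation term vanishes.\<close>
  have "(\<lambda>n. sqrt (real (d n) / real n) * sqrt (1 / real n) + \<bar>real (d n) / real n * p - real (k n) / real n\<bar>)
      \<longlonglongrightarrow> sqrt \<alpha> * sqrt 0 + \<bar>\<alpha> * p - \<alpha> * p\<bar>"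
    by (intro tendsto_intros d k lim_1_over_n)
  moreover have "sqrt (real (d n) / real n) * sqrt (1 / real n) + \<bar>real (d n) / real n * p - real (k n) / real n\<bar> = \<epsilon> n" for n
  proof -
    have "\<bar>real (d n) / real n * p - real (k n) / real n\<bar> = \<bar>(real (d n) * p - real (k n)) / real n\<bar>"
      by (simp add: diff_divide_distrib)
    then show ?thesis
      by (simp add: \<epsilon>_def add_divide_distrib abs_divide real_sqrt_divide)
  qed
  ultimately have \<epsilon>: "\<epsilon> \<longlonglongrightarrow> 0" by simp
  have \<delta>: "\<delta> \<longlonglongrightarrow> 0"
    unfolding \<delta>_def[abs_def] using tendsto_add[OF tendsto_real_sqrt[OF \<epsilon>] lim_1_over_n] by simp
  have "(\<lambda>n. \<bar>t\<bar> * \<epsilon> n + sqrt (\<epsilon> n) / 2 + \<delta> n * (real (d n) / real n) / 2) \<longlonglongrightarrow> \<bar>t\<bar> * 0 + sqrt 0 / 2 + 0 * \<alpha> / 2"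
    by (intro tendsto_intros d \<epsilon> \<delta>) auto
  then have b0: "(\<lambda>n. \<bar>t\<bar> * \<epsilon> n + sqrt (\<epsilon> n) / 2 + \<delta> n * (real (d n) / real n) / 2) \<longlonglongrightarrow> 0" by simp
  have "\<forall>\<^sub>F n in sequentially. norm (E n / real n - real (d n) / real n * \<mu>)
      \<le> \<bar>t\<bar> * \<epsilon> n + sqrt (\<epsilon> n) / 2 + \<delta> n * (real (d n) / real n) / 2"
  proof (rule eventually_sequentiallyI)
    fix n :: nat assume n: "1 \<le> n"
    have \<delta>p: "0 < \<delta> n" using n by (simp add: \<delta>_def add_nonneg_pos \<epsilon>0)
    have "\<epsilon> n = sqrt (\<epsilon> n) * sqrt (\<epsilon> n)" using \<epsilon>0 by simp
    also have "\<dots> \<le> sqrt (\<epsilon> n) * \<delta> n" by (intro mult_left_mono) (auto simp: \<delta>_def \<epsilon>0)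
    finally have 1: "\<epsilon> n / (2 * \<delta> n) \<le> sqrt (\<epsilon> n) / 2" using \<delta>p by (simp add: field_simps)
    have "E n / real n - real (d n) / real n * \<mu> = (E n - real (d n) * \<mu>) / real n"
      by (simp add: diff_divide_distrib)
    then have "norm (E n / real n - real (d n) / real n * \<mu>) = \<bar>E n - real (d n) * \<mu>\<bar> / real n"
      by (simp add: abs_divide)
    also have "\<dots> \<le> ((\<bar>t\<bar> + 1 / (2 * \<delta> n)) * (sqrt (real (d n)) + \<bar>real (d n) * p - real (k n)\<bar>) + \<delta> n * real (d n) / 2) / real n"
      by (intro divide_right_mono E n \<delta>p) simp
    also have "\<dots> = \<bar>t\<bar> * \<epsilon> n + \<epsilon> n / (2 * \<delta> n) + \<delta> n * (real (d n) / real n) / 2"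
      unfolding \<epsilon>_def by (simp add: add_divide_distrib distrib_right distrib_left mult.commute[of "real n"])
    also have "\<dots> \<le> \<bar>t\<bar> * \<epsilon> n + sqrt (\<epsilon> n) / 2 + \<delta> n * (real (d n) / real n) / 2"
      using 1 by simp
    finally show "norm (E n / real n - real (d n) / real n * \<mu>) \<le> \<bar>t\<bar> * \<epsilon> n + sqrt (\<epsilon> n) / 2 + \<delta> n * (real (d n) / real n) / 2" .
  qed
  then have "(\<lambda>n. E n / real n - real (d n) / real n * \<mu>) \<longlonglongrightarrow> 0"
    by (rule Lim_null_comparison[OF _ b0])
  from tendsto_add[OF this tendsto_mult_right[OF d, of \<mu>]] show ?thesis by simp
qed

text \<open>The limiting fraction of selected entries is \<open>\<beta> / \<alpha>\<close>. With a
  set \<open>U\<close> of exactly this Gaussian mass the bias is \<open>o(n)\<close>, and the limit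
  is \<open>\<alpha>\<close> times the integral of \<open>x\<close> over \<open>U\<close>.\<close>

lemma expectation_top_sum_convergent:
  fixes d k :: "nat \<Rightarrow> nat" and M :: "nat \<Rightarrow> 'a measure" and h :: "nat \<Rightarrow> nat \<Rightarrow> 'a \<Rightarrow> real"
  assumes k: "\<And>n. 1 \<le> n \<Longrightarrow> 1 \<le> k n \<and> k n \<le> d n"
    and d_lim: "(\<lambda>n. real (d n) / real n) \<longlonglongrightarrow> \<alpha>" and k_lim: "(\<lambda>n. real (k n) / real n) \<longlonglongrightarrow> \<beta>" and \<beta>: "0 < \<beta>"
    and prob: "\<And>n. 1 \<le> n \<Longrightarrow> prob_space (M n)"
    and h: "\<And>n i. 1 \<le> n \<Longrightarrow> i \<in> {1..d n} \<Longrightarrow> distributed (M n) lborel (h n i) std_normal_density"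
    and ind: "\<And>n. 1 \<le> n \<Longrightarrow> prob_space.indep_vars (M n) (\<lambda>_. borel) (h n) {1..d n}"
  shows "convergent (\<lambda>n. prob_space.expectation (M n) (\<lambda>\<omega>. top_sum (d n) (k n) (\<lambda>i. h n i \<omega>)) / real n)"
proof -
  \<comment> \<open>From \<open>k n \<le> d n\<close>; together with \<open>0 < \<beta>\<close> it
    makes the fraction an admissible mass in \<open>exists_threshold_set\<close>.\<close>
  have "\<beta> \<le> \<alpha>"
    by (rule LIMSEQ_le[OF k_lim d_lim]) (use k in \<open>auto intro!: exI[of _ 1] divide_right_mono\<close>)
  then have p: "0 < \<beta> / \<alpha>" "\<beta> / \<alpha> \<le> 1" "\<alpha> * (\<beta> / \<alpha>) = \<beta>" using \<beta> by auto
  obtain t U where U: "threshold_set t U" "measure std_normal_distribution U = \<beta> / \<alpha>"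
    using exists_threshold_set[OF p(1,2)] .
  have "(\<lambda>n. prob_space.expectation (M n) (\<lambda>\<omega>. top_sum (d n) (k n) (\<lambda>i. h n i \<omega>)) / real n)
      \<longlonglongrightarrow> \<alpha> * (\<integral>x. x * indicator U x \<partial>std_normal_distribution)"
  proof (rule top_sum_scaling_limit[OF d_lim, of k "\<beta> / \<alpha>" _ _ t])
    show "(\<lambda>n. real (k n) / real n) \<longlonglongrightarrow> \<alpha> * (\<beta> / \<alpha>)" unfolding p(3) by (rule k_lim)
    fix n :: nat and \<delta> :: real assume n: "1 \<le> n" "0 < \<delta>"
    have "k n \<le> d n" "1 \<le> d n" using k[OF n(1)] by auto
    from prob_space.expectation_top_sum_bound(2)[OF prob[OF n(1)] this h[OF n(1)] ind[OF n(1)] U(1) n(2)]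
    show "\<bar>prob_space.expectation (M n) (\<lambda>\<omega>. top_sum (d n) (k n) (\<lambda>i. h n i \<omega>))
        - real (d n) * (\<integral>x. x * indicator U x \<partial>std_normal_distribution)\<bar>
      \<le> (\<bar>t\<bar> + 1 / (2 * \<delta>)) * (sqrt (real (d n)) + \<bar>real (d n) * (\<beta> / \<alpha>) - real (k n)\<bar>) + \<delta> * real (d n) / 2"
      unfolding U(2) .
  qed
  then show ?thesis by (rule convergentI)
qed

text \<open>The left side is a \<open>limsup\<close> because existence of the limit of
  \<open>E_xi\<close> is not asserted. For positive \<open>\<beta>1\<close> and
  \<open>\<beta>2\<close> the factors \<open>n / k1\<close> and \<open>n / k2\<close> stay bounded
  and the limit of \<open>E_L\<close> is shown to exist. The spaces \<open>M n\<close> for different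
  \<open>n\<close> are unrelated.\<close>

theorem theorem1:
  fixes m k1 k2 :: "nat \<Rightarrow> nat"
    and \<alpha> \<beta>1 \<beta>2 :: real
    and M :: "nat \<Rightarrow> 'a measure"
    and A :: "nat \<Rightarrow> nat \<Rightarrow> nat \<Rightarrow> 'a \<Rightarrow> real"
    and h g :: "nat \<Rightarrow> nat \<Rightarrow> 'a \<Rightarrow> real"
  defines "E_xi \<equiv> \<lambda>n. prob_space.expectation (M n)
        (\<lambda>\<omega>. largest_avg_submatrix (m n) n (k1 n) (k2 n) (\<lambda>i j. A n i j \<omega>) * sqrt (real n))"
    and "E_L \<equiv> \<lambda>n. prob_space.expectation (M n)
        (\<lambda>\<omega>. random_dual (m n) n (k1 n) (k2 n) (\<lambda>i. h n i \<omega>) (\<lambda>j. g n j \<omega>) * sqrt (real n))"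
  assumes m_pos: "\<And>n. 1 \<le> n \<Longrightarrow> 1 \<le> m n"
    and k1_range: "\<And>n. 1 \<le> n \<Longrightarrow> 1 \<le> k1 n \<and> k1 n \<le> m n"
    and k2_range: "\<And>n. 1 \<le> n \<Longrightarrow> 1 \<le> k2 n \<and> k2 n \<le> n"
    and alpha: "(\<lambda>n. real (m n) / real n) \<longlonglongrightarrow> \<alpha>"
    and beta1: "(\<lambda>n. real (k1 n) / real n) \<longlonglongrightarrow> \<beta>1"
    and beta2: "(\<lambda>n. real (k2 n) / real n) \<longlonglongrightarrow> \<beta>2"
    and prob: "\<And>n. 1 \<le> n \<Longrightarrow> prob_space (M n)"
    and A_normal: "\<And>n i j. 1 \<le> n \<Longrightarrow> i \<in> {1..m n} \<Longrightarrow> j \<in> {1..n} \<Longrightarrow>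
          distributed (M n) lborel (A n i j) std_normal_density"
    and h_normal: "\<And>n i. 1 \<le> n \<Longrightarrow> i \<in> {1..m n} \<Longrightarrow>
          distributed (M n) lborel (h n i) std_normal_density"
    and g_normal: "\<And>n j. 1 \<le> n \<Longrightarrow> j \<in> {1..n} \<Longrightarrow>
          distributed (M n) lborel (g n j) std_normal_density"
    and indep: "\<And>n. 1 \<le> n \<Longrightarrow>
          prob_space.indep_vars (M n) (\<lambda>_. borel)
            (case_sum (\<lambda>(i, j). A n i j) (case_sum (h n) (g n)))
            (({1..m n} \<times> {1..n}) <+> ({1..m n} <+> {1..n}))"
  shows "limsup (\<lambda>n. ereal (E_xi n)) \<le> limsup (\<lambda>n. ereal (E_L n)) \<and>
         (0 < \<beta>1 \<and> 0 < \<beta>2 \<longrightarrow>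
            convergent E_L \<and> limsup (\<lambda>n. ereal (E_xi n)) \<le> ereal (lim E_L))"
proof (intro conjI impI)
  \<comment> \<open>Joint independence is given over a sum type; the vectors are recovered by
    restricting to the image of an injection and pulling the index back along it.\<close>
  have indh: "prob_space.indep_vars (M n) (\<lambda>_. borel) (h n) {1..m n}"
    and indg: "prob_space.indep_vars (M n) (\<lambda>_. borel) (g n) {1..n}" if n: "1 \<le> n" for n
  proof -
    interpret prob_space "M n" by (rule prob[OF n])
    have sub: "(\<lambda>i. Inr (Inl i)) ` {1..m n} \<subseteq> ({1..m n} \<times> {1..n}) <+> ({1..m n} <+> {1..n})"
      "(\<lambda>i. Inr (Inr i)) ` {1..n} \<subseteq> ({1..m n} \<times> {1..n}) <+> ({1..m n} <+> {1..n})" by auto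
    show "indep_vars (\<lambda>_. borel) (h n) {1..m n}"
      using indep_vars_reindex[OF _ indep_vars_subset[OF indep[OF n] sub(1)]] by (simp add: inj_on_def)
    show "indep_vars (\<lambda>_. borel) (g n) {1..n}"
      using indep_vars_reindex[OF _ indep_vars_subset[OF indep[OF n] sub(2)]] by (simp add: inj_on_def)
  qed
  have le: "E_xi n \<le> E_L n" if n: "1 \<le> n" for n
  proof -
    interpret prob_space "M n" by (rule prob[OF n])
    have k: "1 \<le> k1 n" "k1 n \<le> m n" "1 \<le> k2 n" "k2 n \<le> n" using k1_range[OF n] k2_range[OF n] by auto
    from expectation_largest_avg_submatrix_le_random_dual[OF k A_normal[OF n] h_normal[OF n] g_normal[OF n] indep[OF n]]
    show ?thesis unfolding E_xi_def E_L_def integral_mult_left_zero by (intro mult_right_mono) auto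
  qed
  show lim_le: "limsup (\<lambda>n. ereal (E_xi n)) \<le> limsup (\<lambda>n. ereal (E_L n))"
    by (intro Limsup_mono eventually_sequentiallyI[of 1]) (simp add: le)
  assume \<beta>: "0 < \<beta>1 \<and> 0 < \<beta>2"
  define H where "H n = prob_space.expectation (M n) (\<lambda>\<omega>. top_sum (m n) (k1 n) (\<lambda>i. h n i \<omega>)) / real n" for n
  define G where "G n = prob_space.expectation (M n) (\<lambda>\<omega>. top_sum n (k2 n) (\<lambda>i. g n i \<omega>)) / real n" for n
  \<comment> \<open>At \<open>n = 0\<close> the quotient is 0, so it equals 1 only
    eventually.\<close>
  have one: "(\<lambda>n. real n / real n) \<longlonglongrightarrow> 1"
    by (rule Lim_transform_eventually[OF tendsto_const]) (auto intro!: eventually_sequentiallyI[of 1])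
  have "convergent H" unfolding H_def[abs_def]
    using \<beta> by (intro expectation_top_sum_convergent[OF k1_range alpha beta1 _ prob h_normal indh]) auto
  then obtain H' where H: "H \<longlonglongrightarrow> H'" by (auto simp: convergent_def)
  have "convergent G" unfolding G_def[abs_def]
    using \<beta> by (intro expectation_top_sum_convergent[OF k2_range one beta2 _ prob g_normal indg]) auto
  then obtain G' where G: "G \<longlonglongrightarrow> G'" by (auto simp: convergent_def)
  \<comment> \<open>The powers of \<open>n\<close> are distributed so that only convergent ratios
    remain: \<open>n * sqrt n / (k1 * sqrt k2)\<close> equals
    \<open>(n / k1) * sqrt (n / k2)\<close>, and likewise with \<open>k1\<close> and
    \<open>k2\<close> exchanged.\<close>
  have E_L_eq: "inverse (real (k1 n) / real n) * sqrt (inverse (real (k2 n) / real n)) * H n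
        + inverse (real (k2 n) / real n) * sqrt (inverse (real (k1 n) / real n)) * G n = E_L n" if n: "1 \<le> n" for n
  proof -
    interpret prob_space "M n" by (rule prob[OF n])
    have k: "1 \<le> k1 n" "k1 n \<le> m n" "1 \<le> k2 n" "k2 n \<le> n" using k1_range[OF n] k2_range[OF n] by auto
    have mn: "1 \<le> m n" by (rule m_pos[OF n])
    \<comment> \<open>An arbitrary admissible threshold set, since only the integrability part of
      \<open>expectation_top_sum_bound\<close> is drawn on here.\<close>
    have U: "threshold_set 0 UNIV" by (simp add: threshold_set_def)
    have ih: "integrable (M n) (\<lambda>\<omega>. top_sum (m n) (k1 n) (\<lambda>i. h n i \<omega>))"
      by (rule expectation_top_sum_bound(1)[OF k(2) mn h_normal[OF n] indh[OF n] U zero_less_one])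
    have ig: "integrable (M n) (\<lambda>\<omega>. top_sum n (k2 n) (\<lambda>i. g n i \<omega>))"
      by (rule expectation_top_sum_bound(1)[OF k(4) n g_normal[OF n] indg[OF n] U zero_less_one])
    have "E_L n = 1 / sqrt (real (k1 n) * real (k2 n)) *
        (expectation (\<lambda>\<omega>. top_sum (m n) (k1 n) (\<lambda>i. h n i \<omega>)) / sqrt (k1 n)
         + expectation (\<lambda>\<omega>. top_sum n (k2 n) (\<lambda>i. g n i \<omega>)) / sqrt (k2 n)) * sqrt (real n)"
      unfolding E_L_def random_dual_top_sum[OF k] using ih ig by simp
    also have "\<dots> = 1 / sqrt (real (k1 n) * real (k2 n)) * (real n * H n / sqrt (k1 n) + real n * G n / sqrt (k2 n)) * sqrt (real n)"
      using n by (simp add: H_def G_def)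
    also have "\<dots> = inverse (real (k1 n) / real n) * sqrt (inverse (real (k2 n) / real n)) * H n
        + inverse (real (k2 n) / real n) * sqrt (inverse (real (k1 n) / real n)) * G n"
      using n k by (simp add: real_sqrt_mult real_sqrt_divide field_simps)
    finally show ?thesis ..
  qed
  have "(\<lambda>n. inverse (real (k1 n) / real n) * sqrt (inverse (real (k2 n) / real n)) * H n
        + inverse (real (k2 n) / real n) * sqrt (inverse (real (k1 n) / real n)) * G n)
      \<longlonglongrightarrow> inverse \<beta>1 * sqrt (inverse \<beta>2) * H' + inverse \<beta>2 * sqrt (inverse \<beta>1) * G'" (is "_ \<longlonglongrightarrow> ?L")
    using \<beta> by (intro tendsto_intros beta1 beta2 H G) auto
  then have L: "E_L \<longlonglongrightarrow> ?L"
    by (rule Lim_transform_eventually) (rule eventually_sequentiallyI[of 1], rule E_L_eq)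
  then show "convergent E_L" by (rule convergentI)
  have "limsup (\<lambda>n. ereal (E_L n)) = ereal ?L"
    using L by (intro lim_imp_Limsup) auto
  with lim_le limI[OF L] show "limsup (\<lambda>n. ereal (E_xi n)) \<le> ereal (lim E_L)" by simp
qed

end
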